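(* Let $f,g$ be nonconstant entire functions of finite exponential type such that $$\sup_{z\in\mathbb{C}}\min\{|f(z)|,|g(z)|\}\le 1.$$ Then for every $\varepsilon>0$ there exists a set $E_\varepsilon\subset\mathbb{R}_+$ of finite Lebesgue measure such that for every $\tau\in\mathbb{R}_+\setminus E_\varepsilon$ there exist a semicircle $C\subset\{z: |z|=e^\tau\}$ and a set $B\subset\{z:|z|=e^\tau\}$ of angular measure at most $\varepsilon$ with $$|f(z)|\le 1,\quad |g(z)|>1\qquad\text{for } z\in C\setminus B,$$ $$|f(z)|>1,\quad |g(z)|\le 1\qquad\text{for } z\in(-C)\setminus B.$$
   Context: An entire function $F$ is of finite exponential type if there are constants $A,B_0>0$ with $|F(z)|\le A e^{B_0|z|}$ for all $z\in\mathbb{C}$. The angular measure of a subset of the circle $\{|z|=e^\tau\}$ is the Lebesgue measure of the corresponding set of angles $\theta\in[0,2\pi)$, $z=e^\tau e^{i\theta}$ (so the full circle has angular measure $2\pi$); a semicircle is an arc of angular measure $\pi$. $-C=\{-z: z\in C\}$ is the opposite semicircle. *)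

theory Defs
  imports "HOL-Analysis.Analysis"
begin

text \<open>Growth condition only: that the function is entire is assumed separately, as
  \<open>F holomorphic_on UNIV\<close>.\<close>

definition finite_exponential_type :: "(complex \<Rightarrow> complex) \<Rightarrow> bool" where
  "finite_exponential_type F \<longleftrightarrow>
     (\<exists>A>0. \<exists>B0>0. \<forall>z. norm (F z) \<le> A * exp (B0 * norm z))"

definition angle_set :: "real \<Rightarrow> complex set \<Rightarrow> real set" where
  "angle_set r S = {\<theta> \<in> {0..<2*pi}. complex_of_real r * cis \<theta> \<in> S}"

text \<open>\<open>measure\<close> returns \<open>0\<close> on non-measurable sets, so an upper bound on
  \<open>angular_measure r S\<close> is meaningful only together with \<open>angular_measurable r S\<close>.\<close>

definition angular_measurable :: "real \<Rightarrow> complex set \<Rightarrow> bool" where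
  "angular_measurable r S \<longleftrightarrow> angle_set r S \<in> sets lebesgue"

definition angular_measure :: "real \<Rightarrow> complex set \<Rightarrow> real" where
  "angular_measure r S = measure lebesgue (angle_set r S)"

text \<open>Arcs contain their endpoints.\<close>

definition circular_arc :: "real \<Rightarrow> complex set \<Rightarrow> bool" where
  "circular_arc r C \<longleftrightarrow>
     (\<exists>a b. a \<le> b \<and> C = (\<lambda>\<theta>. complex_of_real r * cis \<theta>) ` {a..b})"

definition semicircle :: "real \<Rightarrow> complex set \<Rightarrow> bool" where
  "semicircle r C \<longleftrightarrow> circular_arc r C \<and> angular_measure r C = pi"

end

theory Submission
  imports Defs "HOL-Complex_Analysis.Complex_Analysis"
begin

text \<open>Put \<open>W = P(|f(e\<^sup>z)|\<^sup>2)\<close>, where \<open>P\<close> is a \<open>C\<^sup>2\<close> variant of \<open>log\<^sup>+\<close> for which \<open>W\<close> is subharmonic, and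
  \<open>\<phi>(x) = \<integral> W(x+iy)\<^sup>2 dy\<close> over a period. If \<open>\<Lambda>\<^sup>2\<close> denotes the Rayleigh quotient \<open>\<integral> W\<^sub>y\<^sup>2 / \<integral> W\<^sup>2\<close>, then
  \<open>\<phi>'' \<ge> 2 \<integral> (W\<^sub>x\<^sup>2 + \<Lambda>\<^sup>2 W\<^sup>2) \<ge> 2 \<Lambda> \<phi>'\<close>, so \<open>\<integral> \<Lambda>\<close> up to \<open>T\<close> is at most \<open>(1/2) log \<phi>'(T) + O(1) \<le> T + O(1)\<close>, by the growth
  hypothesis (Carleman's argument). By Wirtinger's inequality \<open>\<Lambda> < \<pi>/l\<close> forces \<open>|f| > 1\<close> on an arc of length \<open>l\<close>.
  Such arcs for \<open>f\<close> and \<open>g\<close> are disjoint, whence \<open>1/\<Lambda>\<^sub>f + 1/\<Lambda>\<^sub>g \<le> 2\<close> and \<open>\<Lambda>\<^sub>f + \<Lambda>\<^sub>g \<ge> 2\<close>. The excess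
  \<open>\<Lambda>\<^sub>f + \<Lambda>\<^sub>g - 2\<close> is integrable, so it is small outside a set of finite measure; where it is small, both arcs
  have length almost \<open>\<pi>\<close> and are almost opposite.\<close>

subsection \<open>A smooth positive logarithm\<close>

text \<open>Only \<open>s = a\<close> needs an argument: there the difference quotient is either
  \<open>0\<close> or that of \<open>Q\<close>, which tends to \<open>Q' a = 0\<close>. Applying
  this to a function and then to its derivative gives a twice differentiable extension by a
  constant.\<close>

lemma DERIV_compose_max:
  fixes Q Q' :: "real \<Rightarrow> real"
  assumes Q: "\<And>t. t \<ge> a \<Longrightarrow> (Q has_real_derivative Q' t) (at t)" and "Q' a = 0"
  shows "((\<lambda>s. Q (max a s)) has_real_derivative Q' (max a s)) (at s)"
proof -
  consider "s < a" | "s > a" | "s = a" by linarith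
  then show ?thesis
  proof cases
    case 1
    have "((\<lambda>s. Q a) has_real_derivative 0) (at s)" by simp
    moreover have "\<forall>\<^sub>F x in nhds s. Q a = Q (max a x)"
      using eventually_nhds_in_open[of "{..<a}" s] 1 by (auto elim!: eventually_mono)
    ultimately have "((\<lambda>s. Q (max a s)) has_real_derivative 0) (at s)"
      by (simp only: DERIV_cong_ev[OF refl _ refl])
    then show ?thesis using 1 assms(2) by (simp add: max_def)
  next
    case 2
    have "\<forall>\<^sub>F x in nhds s. Q x = Q (max a x)"
      using eventually_nhds_in_open[of "{a<..}" s] 2 by (auto elim!: eventually_mono)
    then have "((\<lambda>s. Q (max a s)) has_real_derivative Q' s) (at s)"
      using Q[of s] 2 by (simp only: DERIV_cong_ev[OF refl _ refl, symmetric] less_imp_le)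
    then show ?thesis using 2 by (simp add: max_def)
  next
    case 3
    have "((\<lambda>y. (Q y - Q a) / (y - a)) \<longlongrightarrow> 0) (at a)"
      using Q[of a] assms(2) by (simp add: has_field_derivative_iff)
    then have "((\<lambda>y. norm ((Q y - Q a) / (y - a))) \<longlongrightarrow> 0) (at a)"
      by (rule tendsto_norm_zero)
    then have "((\<lambda>y. (Q (max a y) - Q a) / (y - a)) \<longlongrightarrow> 0) (at a)"
      by (rule Lim_null_comparison[rotated]) (auto simp: max_def)
    then show ?thesis using 3 assms(2) by (simp add: has_field_derivative_iff)
  qed
qed

text \<open>Chosen so that \<open>s * cutoff_log1 s = (1 - 1/s)\<^sup>2\<close> for \<open>s \<ge> 1\<close>, where \<open>cutoff_log1\<close> is the derivative:
  its monotonicity is the subharmonicity of \<open>cutoff_log (|F|\<^sup>2)\<close>, and its double zero at \<open>1\<close> makes the extension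
  by \<open>0\<close> twice continuously differentiable.\<close>

definition cutoff_log :: "real \<Rightarrow> real" where
  "cutoff_log s = (let t = max 1 s in ln t + 2 / t - 1 / (2 * t^2) - 3/2)"

definition cutoff_log1 :: "real \<Rightarrow> real" where
  "cutoff_log1 s = (let t = max 1 s in (t - 1)^2 / t^3)"

definition cutoff_log2 :: "real \<Rightarrow> real" where
  "cutoff_log2 s = (let t = max 1 s in (t - 1) * (3 - t) / t^4)"

lemma DERIV_cutoff_log: "(cutoff_log has_real_derivative cutoff_log1 s) (at s)"
  unfolding cutoff_log_def[abs_def] cutoff_log1_def Let_def
proof (rule DERIV_compose_max)
  fix t :: real assume t: "t \<ge> 1"
  show "((\<lambda>t. ln t + 2 / t - 1 / (2 * t\<^sup>2) - 3 / 2) has_real_derivative (t - 1)\<^sup>2 / t^3) (at t)"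
    using t
    by (auto intro!: derivative_eq_intros)
       (simp add: field_simps power2_eq_square power3_eq_cube power4_eq_xxxx)
qed auto

lemma DERIV_cutoff_log1: "(cutoff_log1 has_real_derivative cutoff_log2 s) (at s)"
  unfolding cutoff_log1_def[abs_def] cutoff_log2_def Let_def
proof (rule DERIV_compose_max)
  fix t :: real assume t: "t \<ge> 1"
  show "((\<lambda>t. (t - 1)\<^sup>2 / t^3) has_real_derivative (t - 1) * (3 - t) / t^4) (at t)"
    using t
    by (auto intro!: derivative_eq_intros) (simp add: field_simps eval_nat_numeral)
qed auto

lemma continuous_on_cutoff_log [continuous_intros]:
  assumes "continuous_on S h"
  shows "continuous_on S (\<lambda>z. cutoff_log (h z))" "continuous_on S (\<lambda>z. cutoff_log1 (h z))"
    "continuous_on S (\<lambda>z. cutoff_log2 (h z))"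
proof -
  have "max 1 (h z) \<noteq> 0" for z by (simp add: max_def)
  then show "continuous_on S (\<lambda>z. cutoff_log (h z))" "continuous_on S (\<lambda>z. cutoff_log1 (h z))"
    "continuous_on S (\<lambda>z. cutoff_log2 (h z))"
    unfolding cutoff_log_def cutoff_log1_def cutoff_log2_def Let_def
    by (intro continuous_intros assms; simp)+
qed

lemma cutoff_log_eq_0: "s \<le> 1 \<Longrightarrow> cutoff_log s = 0"
  by (simp add: cutoff_log_def)

lemma cutoff_log_pos: "s > 1 \<Longrightarrow> cutoff_log s > 0"
proof -
  assume s: "s > 1"
  have "\<exists>z>1. z < s \<and> cutoff_log s - cutoff_log 1 = (s - 1) * cutoff_log1 z"
    using MVT2[OF s, of cutoff_log cutoff_log1] DERIV_cutoff_log by auto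
  then show ?thesis using s by (auto simp: cutoff_log_eq_0 cutoff_log1_def)
qed

lemma cutoff_log_nonneg: "cutoff_log s \<ge> 0"
  using cutoff_log_eq_0[of s] cutoff_log_pos[of s] by linarith

lemma cutoff_log_le: "s \<ge> 1 \<Longrightarrow> cutoff_log s \<le> ln s + 1/2"
proof -
  assume s: "s \<ge> 1"
  have "2 / s \<le> 2" using s by (simp add: divide_le_eq)
  moreover have "0 \<le> 1 / (2 * s\<^sup>2)" by simp
  ultimately show ?thesis
    using s unfolding cutoff_log_def Let_def max_absorb2[OF s] by linarith
qed

lemma cutoff_log_ge: "s \<ge> 1 \<Longrightarrow> cutoff_log s \<ge> ln s - 3/2"
proof -
  assume s: "s \<ge> 1"
  have "1 / (2 * s\<^sup>2) \<le> 1 / s"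
    using s by (simp add: field_simps power2_eq_square)
  moreover have "1 / s \<le> 2 / s"
    using s by (simp add: divide_right_mono)
  ultimately show ?thesis using s by (simp add: cutoff_log_def)
qed

text \<open>This is the derivative of \<open>s * cutoff_log1 s\<close>, hence of
  \<open>(1 - 1/s)^2\<close> for \<open>s \<ge> 1\<close>.\<close>

lemma cutoff_log_subharmonic: "s * cutoff_log2 s + cutoff_log1 s \<ge> 0"
proof (cases "s \<le> 1")
  case False
  then have "s * cutoff_log2 s + cutoff_log1 s = 2 * (s - 1) / s^3"
    by (simp add: cutoff_log1_def cutoff_log2_def field_simps) (simp add: eval_nat_numeral algebra_simps)
  then show ?thesis using False by simp
qed (simp add: cutoff_log1_def cutoff_log2_def)

subsection \<open>Wirtinger inequality\<close>

text \<open>Expand \<open>\<integral> (w' + k tan (k (x - c)) w)\<^sup>2 \<ge> 0\<close>, where \<open>c\<close> is the midpoint of \<open>[a, b]\<close>.\<close>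

lemma wirtinger_Dirichlet:
  fixes w w' :: "real \<Rightarrow> real"
  assumes "a \<le> b" and "k \<ge> 0" and "k * (b - a) < pi" and "w a = 0" and "w b = 0"
    and deriv: "\<And>x. (w has_real_derivative w' x) (at x)" and cont: "continuous_on UNIV w'"
  shows "integral {a..b} (\<lambda>x. (w' x)^2 - k^2 * (w x)^2) \<ge> 0"
proof -
  define c where "c = (a + b) / 2"
  define q where "q x = k * tan (k * (x - c))" for x
  have cos: "cos (k * (x - c)) > 0" if "x \<in> {a..b}" for x
  proof (rule cos_gt_zero_pi)
    have "x - c \<le> (b - a) / 2" "-((b - a) / 2) \<le> x - c"
      using that by (auto simp: c_def field_simps)
    then have "k * (x - c) \<le> k * ((b - a) / 2)" "k * (-((b - a) / 2)) \<le> k * (x - c)"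
      using \<open>k \<ge> 0\<close> by (auto simp only: intro: mult_left_mono)
    then show "k * (x - c) < pi/2" "- (pi/2) < k * (x - c)"
      using assms(3) by (auto simp: field_simps)
  qed
  have wc: "continuous_on S w" "continuous_on S w'" for S
    using DERIV_continuous_on deriv cont continuous_on_subset by (blast intro: has_field_derivative_at_within)+
  have qc: "continuous_on {a..b} q"
    unfolding q_def using cos by (intro continuous_intros) force
  \<comment> \<open>\<open>q\<close> solves the Riccati equation \<open>q' = k^2 + q^2\<close>, so
    the integrand is the derivative of \<open>w^2 * q\<close>. The bound on
    \<open>k * (b - a)\<close> keeps the tangent away from its poles.\<close>
  have "((\<lambda>x. 2 * w x * w' x * q x + (w x)^2 * (k^2 + (q x)^2)) has_integral ((w b)^2 * q b - (w a)^2 * q a)) {a..b}"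
  proof (rule fundamental_theorem_of_calculus[OF \<open>a \<le> b\<close>])
    fix x assume x: "x \<in> {a..b}"
    have eq: "1 / (cos (k * (x - c)))^2 = 1 + (tan (k * (x - c)))^2"
      using cos[OF x] sin_cos_squared_add[of "k*(x-c)"]
      by (simp add: tan_def field_simps)
    have "(q has_real_derivative (k^2 + (q x)^2)) (at x)"
      unfolding q_def
      using cos[OF x] eq
      by (auto intro!: derivative_eq_intros simp: inverse_eq_divide algebra_simps power2_eq_square)
    then have "((\<lambda>x. (w x)^2 * q x) has_real_derivative 2 * w x * w' x * q x + (w x)^2 * (k^2 + (q x)^2)) (at x)"
      by (auto intro!: derivative_eq_intros deriv)
    then show "((\<lambda>x. (w x)^2 * q x) has_vector_derivative 2 * w x * w' x * q x + (w x)^2 * (k^2 + (q x)^2)) (at x within {a..b})"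
      by (simp add: has_real_derivative_iff_has_vector_derivative has_vector_derivative_at_within)
  qed
  then have I: "((\<lambda>x. 2 * w x * w' x * q x + (w x)^2 * (k^2 + (q x)^2)) has_integral 0) {a..b}"
    using assms by simp
  have J: "(\<lambda>x. (w' x)^2 - k^2 * (w x)^2) integrable_on {a..b}"
    by (intro integrable_continuous_real continuous_intros wc)
  have "((\<lambda>x. (w' x + q x * w x)^2) has_integral (integral {a..b} (\<lambda>x. (w' x)^2 - k^2 * (w x)^2) + 0)) {a..b}"
    by (rule has_integral_eq[OF _ has_integral_add[OF integrable_integral[OF J] I]])
       (simp add: algebra_simps power2_eq_square)
  from has_integral_nonneg[OF this] show ?thesis by simp
qed

text \<open>Cut \<open>[a, b]\<close> at zeros of \<open>w\<close> into pieces of length at most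
  \<open>l + \<eta>\<close> and apply \<open>wirtinger_Dirichlet\<close> to each. Each zero is
  sought in a window of length \<open>l\<close> that starts \<open>\<eta>\<close> beyond the
  previous one, so every cut advances by at least \<open>\<eta>\<close> and finitely many
  suffice.\<close>

lemma wirtinger_gaps:
  fixes w w' :: "real \<Rightarrow> real"
  assumes "k \<ge> 0" and "\<eta> > 0" and "l > 0" and "k * (l + \<eta>) < pi"
    and zeros: "\<And>x. \<exists>z\<in>{x..x+l}. w z = 0"
    and deriv: "\<And>x. (w has_real_derivative w' x) (at x)" and cont: "continuous_on UNIV w'"
    and "a \<le> b" and "w a = 0" and "w b = 0"
  shows "integral {a..b} (\<lambda>x. (w' x)^2 - k^2 * (w x)^2) \<ge> 0"
proof -
  have wc: "continuous_on S w" "continuous_on S w'" for S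
    using DERIV_continuous_on deriv cont continuous_on_subset by (blast intro: has_field_derivative_at_within)+
  have J: "(\<lambda>x. (w' x)^2 - k^2 * (w x)^2) integrable_on {a..b}" for a b
    by (intro integrable_continuous_real continuous_intros wc)
  have main: "b - a \<le> of_nat n * \<eta> \<Longrightarrow> a \<le> b \<Longrightarrow> w a = 0 \<Longrightarrow>
    integral {a..b} (\<lambda>x. (w' x)^2 - k^2 * (w x)^2) \<ge> 0" for n a
  proof (induction n arbitrary: a)
    case 0
    then show ?case by simp
  next
    case (Suc n)
    show ?case
    proof (cases "b - a \<le> l + \<eta>")
      case True
      then have "k * (b - a) < pi"
        using assms(1,4) mult_left_mono[of "b - a" "l + \<eta>" k] by linarith
      then show ?thesis
        using wirtinger_Dirichlet[OF _ \<open>k \<ge> 0\<close> _ _ \<open>w b = 0\<close> deriv cont] Suc by blast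
    next
      case False
      obtain z where z: "z \<in> {a + \<eta>..a + \<eta> + l}" "w z = 0" using zeros by blast
      have "k * (z - a) < pi"
        using z assms(1,4) mult_left_mono[of "z - a" "l + \<eta>" k] by auto
      then have 1: "integral {a..z} (\<lambda>x. (w' x)^2 - k^2 * (w x)^2) \<ge> 0"
        using z \<open>\<eta> > 0\<close> by (intro wirtinger_Dirichlet \<open>k \<ge> 0\<close> deriv cont Suc) auto
      have 2: "integral {z..b} (\<lambda>x. (w' x)^2 - k^2 * (w x)^2) \<ge> 0"
        using Suc.prems z False by (intro Suc.IH) (auto simp: algebra_simps)
      have "integral {a..z} (\<lambda>x. (w' x)^2 - k^2 * (w x)^2) + integral {z..b} (\<lambda>x. (w' x)^2 - k^2 * (w x)^2)
        = integral {a..b} (\<lambda>x. (w' x)^2 - k^2 * (w x)^2)"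
        using z \<open>\<eta> > 0\<close> False by (intro Henstock_Kurzweil_Integration.integral_combine J) auto
      then show ?thesis using 1 2 by linarith
    qed
  qed
  obtain n where "(b - a) / \<eta> \<le> of_nat n" using real_arch_simple by blast
  then show ?thesis
    using main[of a n] assms by (simp add: field_simps)
qed

lemma integral_period_shift:
  fixes h :: "real \<Rightarrow> real"
  assumes cont: "continuous_on UNIV h" and per: "\<And>x. h (x + p) = h x" and z: "0 \<le> z" "z \<le> p"
  shows "integral {z..z+p} h = integral {0..p} h"
proof -
  have J: "h integrable_on {a..b}" for a b
    by (rule integrable_continuous_real) (rule continuous_on_subset[OF cont], simp)
  have "integral {z..z+p} h = integral {z..p} h + integral {p..z+p} h"
    using z by (intro Henstock_Kurzweil_Integration.integral_combine[symmetric] J) auto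
  also have "integral {p..z+p} h = integral {0..z} h"
  proof -
    have "h \<circ> (+) p = h" using per by (simp add: fun_eq_iff add.commute)
    then show ?thesis
      using integral_shift_Icc_real[of 0 z h p] by (simp add: add.commute)
  qed
  also have "integral {z..p} h + integral {0..z} h = integral {0..p} h"
    using Henstock_Kurzweil_Integration.integral_combine[OF z J] by simp
  finally show ?thesis .
qed

subsection \<open>Carleman estimate\<close>

lemma has_real_derivative_Re_cnj:
  assumes "(p has_vector_derivative p') (at t)" and "(q has_vector_derivative q') (at t)"
  shows "((\<lambda>t. Re (cnj (p t) * q t)) has_real_derivative Re (cnj p' * q t + cnj (p t) * q')) (at t)"
proof -
  have "((\<lambda>t. cnj (p t)) has_vector_derivative cnj p') (at t)"
    using bounded_linear.has_vector_derivative[OF bounded_linear_cnj assms(1)] .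
  from has_vector_derivative_mult[OF this assms(2)]
  have "((\<lambda>t. cnj (p t) * q t) has_vector_derivative (cnj (p t) * q' + cnj p' * q t)) (at t)" .
  from bounded_linear.has_vector_derivative[OF bounded_linear_Re this]
  show ?thesis by (simp add: has_real_derivative_iff_has_vector_derivative add.commute)
qed

lemma has_vector_derivative_Complex:
  assumes "(G has_field_derivative G') (at (Complex x y))"
  shows "((\<lambda>x. G (Complex x y)) has_vector_derivative G') (at x)"
    and "((\<lambda>y. G (Complex x y)) has_vector_derivative \<i> * G') (at y)"
proof -
  have "((\<lambda>x. Complex x y) has_vector_derivative 1) (at x)"
    "((\<lambda>y. Complex x y) has_vector_derivative \<i>) (at y)"
    unfolding Complex_eq has_vector_derivative_def
    by (auto intro!: derivative_eq_intros simp: scaleR_conv_of_real)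
  from this[THEN field_vector_diff_chain_at, OF assms]
  show "((\<lambda>x. G (Complex x y)) has_vector_derivative G') (at x)"
    "((\<lambda>y. G (Complex x y)) has_vector_derivative \<i> * G') (at y)"
    by (simp_all add: o_def)
qed

section \<open>The subharmonic function \<open>W\<close> in logarithmic coordinates\<close>

locale entire_function =
  fixes f :: "complex \<Rightarrow> complex"
  assumes holo: "f holomorphic_on UNIV"
begin

text \<open>The exponential turns the circle of radius \<open>exp x\<close> into the vertical line
  at \<open>x\<close>, traversed with period \<open>2*pi\<close>.\<close>

definition "F z = f (exp z)"
definition "F1 z = deriv f (exp z) * exp z"
definition "F2 z = deriv (deriv f) (exp z) * exp z * exp z + deriv f (exp z) * exp z"

lemma DERIV_F: "(F has_field_derivative F1 z) (at z)" "(F1 has_field_derivative F2 z) (at z)"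
proof -
  have "(f has_field_derivative deriv f w) (at w)" for w
    using holo holomorphic_derivI open_UNIV by blast
  note 1 = DERIV_chain2[OF this]
  have "(deriv f has_field_derivative deriv (deriv f) w) (at w)" for w
    using holo holomorphic_deriv holomorphic_derivI open_UNIV by blast
  note 2 = DERIV_chain2[OF this]
  show "(F has_field_derivative F1 z) (at z)"
    unfolding F_def[abs_def] F1_def by (auto intro!: derivative_eq_intros 1)
  show "(F1 has_field_derivative F2 z) (at z)"
    unfolding F1_def[abs_def] F2_def by (auto intro!: derivative_eq_intros 2)
qed

text \<open>This is \<open>|F|^2\<close>, written so that \<open>has_real_derivative_Re_cnj\<close>
  yields all its partial derivatives. In \<open>syy\<close> the sign of the \<open>F2\<close> term
  is reversed because each vertical derivative contributes a factor \<open>\<i>\<close>.\<close>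

definition "s z = Re (cnj (F z) * F z)"
definition "sx z = 2 * Re (cnj (F z) * F1 z)"
definition "sy z = 2 * Re (cnj (F z) * (\<i> * F1 z))"
definition "sxx z = 2 * Re (cnj (F1 z) * F1 z + cnj (F z) * F2 z)"
definition "syy z = 2 * Re (cnj (F1 z) * F1 z - cnj (F z) * F2 z)"

lemma DERIV_s:
  "((\<lambda>x. s (Complex x y)) has_real_derivative sx (Complex x y)) (at x)"
  "((\<lambda>y. s (Complex x y)) has_real_derivative sy (Complex x y)) (at y)"
  "((\<lambda>x. sx (Complex x y)) has_real_derivative sxx (Complex x y)) (at x)"
  "((\<lambda>y. sy (Complex x y)) has_real_derivative syy (Complex x y)) (at y)"
proof -
  note h = has_vector_derivative_Complex(1)[OF DERIV_F(1)] has_vector_derivative_Complex(1)[OF DERIV_F(2)]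
  note v = has_vector_derivative_Complex(2)[OF DERIV_F(1)]
    has_vector_derivative_mult_right[OF has_vector_derivative_Complex(2)[OF DERIV_F(2)], of \<i>]
  show "((\<lambda>x. s (Complex x y)) has_real_derivative sx (Complex x y)) (at x)"
    unfolding s_def sx_def
    by (rule DERIV_cong[OF has_real_derivative_Re_cnj[OF h(1) h(1)]]) (simp add: algebra_simps)
  show "((\<lambda>y. s (Complex x y)) has_real_derivative sy (Complex x y)) (at y)"
    unfolding s_def sy_def
    by (rule DERIV_cong[OF has_real_derivative_Re_cnj[OF v(1) v(1)]]) (simp add: algebra_simps)
  show "((\<lambda>x. sx (Complex x y)) has_real_derivative sxx (Complex x y)) (at x)"
    unfolding sx_def sxx_def
    by (rule DERIV_cong[OF DERIV_cmult[OF has_real_derivative_Re_cnj[OF h(1) h(2)]]]) simp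
  show "((\<lambda>y. sy (Complex x y)) has_real_derivative syy (Complex x y)) (at y)"
    unfolding sy_def syy_def
    by (rule DERIV_cong[OF DERIV_cmult[OF has_real_derivative_Re_cnj[OF v(1) v(2)]]]) (simp add: algebra_simps)
qed

definition "W z = cutoff_log (s z)"
definition "Wx z = cutoff_log1 (s z) * sx z"
definition "Wy z = cutoff_log1 (s z) * sy z"
definition "Wxx z = cutoff_log2 (s z) * (sx z)^2 + cutoff_log1 (s z) * sxx z"
definition "Wyy z = cutoff_log2 (s z) * (sy z)^2 + cutoff_log1 (s z) * syy z"

lemma DERIV_W:
  "((\<lambda>x. W (Complex x y)) has_real_derivative Wx (Complex x y)) (at x)"
  "((\<lambda>y. W (Complex x y)) has_real_derivative Wy (Complex x y)) (at y)"
  "((\<lambda>x. Wx (Complex x y)) has_real_derivative Wxx (Complex x y)) (at x)"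
  "((\<lambda>y. Wy (Complex x y)) has_real_derivative Wyy (Complex x y)) (at y)"
proof -
  note c = DERIV_chain2[OF DERIV_cutoff_log] DERIV_chain2[OF DERIV_cutoff_log1]
  show "((\<lambda>x. W (Complex x y)) has_real_derivative Wx (Complex x y)) (at x)"
    "((\<lambda>y. W (Complex x y)) has_real_derivative Wy (Complex x y)) (at y)"
    unfolding W_def Wx_def Wy_def by (rule c DERIV_s)+
  show "((\<lambda>x. Wx (Complex x y)) has_real_derivative Wxx (Complex x y)) (at x)"
    "((\<lambda>y. Wy (Complex x y)) has_real_derivative Wyy (Complex x y)) (at y)"
    unfolding Wx_def Wxx_def Wy_def Wyy_def
    by (rule DERIV_cong[OF DERIV_mult[OF c(2)[OF DERIV_s(1)] DERIV_s(3)]]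
        DERIV_cong[OF DERIV_mult[OF c(2)[OF DERIV_s(2)] DERIV_s(4)]], simp add: power2_eq_square)+
qed

text \<open>The \<open>F2\<close> terms cancel and \<open>sx^2 + sy^2 = 4 * |F|^2 * |F1|^2\<close>,
  which leaves \<open>4 * |F1|^2\<close> times the expression in
  \<open>cutoff_log_subharmonic\<close>.\<close>

lemma W_laplacian_nonneg: "Wxx z + Wyy z \<ge> 0"
proof -
  have "Wxx z + Wyy z = 4 * (cmod (F1 z))^2 * (s z * cutoff_log2 (s z) + cutoff_log1 (s z))"
    unfolding Wxx_def Wyy_def sx_def sy_def sxx_def syy_def s_def cmod_power2
    by (simp add: algebra_simps power2_eq_square)
  then show ?thesis using cutoff_log_subharmonic by simp
qed

lemma continuous_F: "continuous_on S F" "continuous_on S F1" "continuous_on S F2"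
proof -
  have "f holomorphic_on S" "deriv f holomorphic_on S" "deriv (deriv f) holomorphic_on S" for S
    using holo holomorphic_deriv holomorphic_on_subset open_UNIV subset_UNIV by metis+
  then have *: "continuous_on S f" "continuous_on S (deriv f)" "continuous_on S (deriv (deriv f))" for S
    by (auto intro: holomorphic_on_imp_continuous_on)
  show "continuous_on S F" "continuous_on S F1" "continuous_on S F2"
    unfolding F_def[abs_def] F1_def[abs_def] F2_def[abs_def]
    by (intro continuous_intros continuous_on_compose2[OF *(1) _ subset_refl]
        continuous_on_compose2[OF *(2) _ subset_refl] continuous_on_compose2[OF *(3) _ subset_refl])+
qed

lemma continuous_W:
  "continuous_on S W" "continuous_on S Wx" "continuous_on S Wy" "continuous_on S Wxx" "continuous_on S Wyy"
  unfolding W_def[abs_def] Wx_def[abs_def] Wy_def[abs_def] Wxx_def[abs_def] Wyy_def[abs_def]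
    s_def sx_def sy_def sxx_def syy_def
  by (intro continuous_intros continuous_F)+

lemma continuous_Complex_pair:
  assumes "\<And>S. continuous_on S h"
  shows "continuous_on S (\<lambda>p. h (Complex (fst p) (snd p)))" "continuous_on S' (\<lambda>y. h (Complex x y))"
  unfolding Complex_eq
  by (rule continuous_on_compose2[OF assms _ subset_refl]; intro continuous_intros)+

lemma periodic:
  "F (Complex x (y + 2*pi)) = F (Complex x y)" "F1 (Complex x (y + 2*pi)) = F1 (Complex x y)"
  by (simp_all add: F_def F1_def exp_eq_polar flip: cis_mult)

lemma W_periodic: "W (Complex x (y + 2*pi)) = W (Complex x y)" "Wy (Complex x (y + 2*pi)) = Wy (Complex x y)"
  by (simp_all add: W_def Wy_def s_def sy_def periodic)

lemma s_eq: "s (Complex x y) = (cmod (f (of_real (exp x) * cis y)))^2"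
proof -
  have "Re (cnj w * w) = (cmod w)^2" for w
    by (simp add: cmod_power2) (simp add: power2_eq_square)
  then show ?thesis by (simp add: s_def F_def exp_eq_polar)
qed

lemma W_pos_iff: "W (Complex x y) > 0 \<longleftrightarrow> cmod (f (of_real (exp x) * cis y)) > 1"
proof (cases "cmod (f (of_real (exp x) * cis y)) > 1")
  case True
  then show ?thesis
    by (simp add: W_def s_eq cutoff_log_pos one_less_power)
next
  case False
  then show ?thesis
    by (simp add: W_def s_eq cutoff_log_eq_0 power_le_one)
qed

section \<open>Convexity and growth of the square means of \<open>W\<close>\<close>

definition "\<phi> x = integral {0..2*pi} (\<lambda>y. (W (Complex x y))^2)"
definition "\<phi>1 x = integral {0..2*pi} (\<lambda>y. 2 * W (Complex x y) * Wx (Complex x y))"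
definition "\<phi>2 x = integral {0..2*pi} (\<lambda>y. 2 * ((Wx (Complex x y))^2 + W (Complex x y) * Wxx (Complex x y)))"
definition "Dy x = integral {0..2*pi} (\<lambda>y. (Wy (Complex x y))^2)"
text \<open>Where \<open>\<phi> x = 0\<close>, division by zero makes this \<open>0\<close>; the
  estimates that relate it to \<open>Dy\<close> therefore assume
  \<open>\<phi> x > 0\<close>.\<close>

definition "\<Lambda> x = sqrt (Dy x / \<phi> x)"

lemma continuous_pair:
  "continuous_on S (\<lambda>p. W (Complex (fst p) (snd p)))" "continuous_on S (\<lambda>p. Wx (Complex (fst p) (snd p)))"
  "continuous_on S (\<lambda>p. Wy (Complex (fst p) (snd p)))" "continuous_on S (\<lambda>p. Wxx (Complex (fst p) (snd p)))"
  by (intro continuous_Complex_pair(1) continuous_W)+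

lemma continuous_line:
  "continuous_on S (\<lambda>y. W (Complex x y))" "continuous_on S (\<lambda>y. Wx (Complex x y))"
  "continuous_on S (\<lambda>y. Wy (Complex x y))" "continuous_on S (\<lambda>y. Wxx (Complex x y))"
  "continuous_on S (\<lambda>y. Wyy (Complex x y))"
  by (intro continuous_Complex_pair(2) continuous_W)+

lemma DERIV_\<phi>: "(\<phi> has_real_derivative \<phi>1 x) (at x)"
proof -
  have "((\<lambda>x. integral (cbox 0 (2*pi)) (\<lambda>y. (W (Complex x y))^2)) has_field_derivative
      integral (cbox 0 (2*pi)) (\<lambda>y. 2 * W (Complex x y) * Wx (Complex x y))) (at x within UNIV)"
    by (rule leibniz_rule_field_derivative)
       (auto intro!: derivative_eq_intros DERIV_W continuous_intros integrable_continuous_real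
         continuous_line continuous_pair simp: split_beta)
  then show ?thesis by (simp add: \<phi>_def[abs_def] \<phi>1_def)
qed

lemma DERIV_\<phi>1: "(\<phi>1 has_real_derivative \<phi>2 x) (at x)"
proof -
  have "((\<lambda>x. integral (cbox 0 (2*pi)) (\<lambda>y. 2 * W (Complex x y) * Wx (Complex x y))) has_field_derivative
      integral (cbox 0 (2*pi)) (\<lambda>y. 2 * ((Wx (Complex x y))^2 + W (Complex x y) * Wxx (Complex x y)))) (at x within UNIV)"
    by (rule leibniz_rule_field_derivative)
       (auto intro!: derivative_eq_intros DERIV_W continuous_intros integrable_continuous_real
         continuous_line continuous_pair simp: split_beta power2_eq_square algebra_simps)
  then show ?thesis by (simp add: \<phi>1_def[abs_def] \<phi>2_def)
qed

lemma W_nonneg: "W z \<ge> 0"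
  by (simp add: W_def cutoff_log_nonneg)

lemma \<phi>_nonneg: "\<phi> x \<ge> 0" and Dy_nonneg: "Dy x \<ge> 0"
  by (auto simp: \<phi>_def Dy_def intro!: integral_nonneg integrable_continuous_real continuous_intros continuous_line)

text \<open>Subharmonicity and \<open>W \<ge> 0\<close> bound the integral of \<open>W * Wxx\<close>
  below by that of \<open>- W * Wyy\<close>. Integration by parts in \<open>y\<close> turns the
  latter into \<open>Dy x\<close>, the boundary terms cancelling by periodicity.\<close>

lemma \<phi>2_ge: "\<phi>2 x \<ge> 2 * integral {0..2*pi} (\<lambda>y. (Wx (Complex x y))^2) + 2 * Dy x"
proof -
  let ?c = "\<lambda>y. Complex x y"
  note int = integrable_continuous_real[where a = 0 and b = "2*pi"]
  have "((\<lambda>y. (Wy (?c y))^2 + W (?c y) * Wyy (?c y)) has_integral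
      W (?c (2*pi)) * Wy (?c (2*pi)) - W (?c 0) * Wy (?c 0)) {0..2*pi}"
  proof (rule fundamental_theorem_of_calculus)
    fix y
    have "((\<lambda>y. W (?c y) * Wy (?c y)) has_real_derivative (Wy (?c y))^2 + W (?c y) * Wyy (?c y)) (at y)"
      by (rule DERIV_cong[OF DERIV_mult[OF DERIV_W(2) DERIV_W(4)]]) (simp add: power2_eq_square)
    then show "((\<lambda>y. W (?c y) * Wy (?c y)) has_vector_derivative (Wy (?c y))^2 + W (?c y) * Wyy (?c y))
        (at y within {0..2*pi})"
      by (simp add: has_real_derivative_iff_has_vector_derivative has_vector_derivative_at_within)
  qed simp
  then have "((\<lambda>y. (Wy (?c y))^2 + W (?c y) * Wyy (?c y)) has_integral 0) {0..2*pi}"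
    using W_periodic[of x 0] by simp
  from has_integral_mult_right[OF this, of "- 2"]
  have parts: "((\<lambda>y. - 2 * ((Wy (?c y))^2 + W (?c y) * Wyy (?c y))) has_integral 0) {0..2*pi}"
    by simp
  have "0 \<le> integral {0..2*pi} (\<lambda>y. 2 * W (?c y) * (Wxx (?c y) + Wyy (?c y)))"
    by (intro integral_nonneg int continuous_intros continuous_line mult_nonneg_nonneg W_nonneg W_laplacian_nonneg) auto
  also have "\<dots> = integral {0..2*pi} (\<lambda>y. 2 * ((Wx (?c y))^2 + W (?c y) * Wxx (?c y))
      - 2 * (Wx (?c y))^2 - 2 * (Wy (?c y))^2 - (- 2 * ((Wy (?c y))^2 + W (?c y) * Wyy (?c y))))"
    by (rule arg_cong[where f = "integral _"]) (simp add: fun_eq_iff algebra_simps)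
  also have "\<dots> = \<phi>2 x - 2 * integral {0..2*pi} (\<lambda>y. (Wx (?c y))^2) - 2 * Dy x - 0"
    unfolding \<phi>2_def Dy_def
    by (intro integral_unique has_integral_diff parts has_integral_mult_right integrable_integral int
        continuous_intros continuous_line)
  finally show ?thesis by simp
qed

lemma \<phi>2_nonneg: "\<phi>2 x \<ge> 0"
proof -
  have "0 \<le> integral {0..2*pi} (\<lambda>y. (Wx (Complex x y))^2)"
    by (intro integral_nonneg integrable_continuous_real continuous_intros continuous_line) auto
  then show ?thesis using \<phi>2_ge[of x] Dy_nonneg[of x] by linarith
qed

text \<open>Expand the integral of \<open>(Wx - \<Lambda> x * W)^2\<close>, which is nonnegative,
  and insert \<open>Dy x = (\<Lambda> x)^2 * \<phi> x\<close> into
  \<open>\<phi>2_ge\<close>.\<close>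

lemma \<phi>2_ge_mult_\<phi>1:
  assumes "\<phi> x > 0"
  shows "\<phi>2 x \<ge> 2 * \<Lambda> x * \<phi>1 x"
proof -
  let ?c = "\<lambda>y. Complex x y"
  note int = integrable_continuous_real[where a = 0 and b = "2*pi"]
  have "0 \<le> integral {0..2*pi} (\<lambda>y. (Wx (?c y) - \<Lambda> x * W (?c y))^2)"
    by (intro integral_nonneg int continuous_intros continuous_line) auto
  also have "\<dots> = integral {0..2*pi} (\<lambda>y. (Wx (?c y))^2 - \<Lambda> x * (2 * W (?c y) * Wx (?c y)) + (\<Lambda> x)^2 * (W (?c y))^2)"
    by (rule arg_cong[where f = "integral _"]) (simp add: fun_eq_iff algebra_simps power2_eq_square)
  also have "\<dots> = integral {0..2*pi} (\<lambda>y. (Wx (?c y))^2) - \<Lambda> x * \<phi>1 x + (\<Lambda> x)^2 * \<phi> x"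
    unfolding \<phi>_def \<phi>1_def
    by (intro integral_unique has_integral_diff has_integral_add has_integral_mult_right integrable_integral int
        continuous_intros continuous_line)
  also have "(\<Lambda> x)^2 * \<phi> x = Dy x"
    using assms Dy_nonneg[of x] by (simp add: \<Lambda>_def)
  finally show ?thesis using \<phi>2_ge[of x] by simp
qed

lemma \<phi>1_mono: "a \<le> b \<Longrightarrow> \<phi>1 a \<le> \<phi>1 b"
  using DERIV_nonneg_imp_nondecreasing[of a b \<phi>1] DERIV_\<phi>1 \<phi>2_nonneg by blast

text \<open>The half-plane \<open>x \<le> 0\<close> is mapped by \<open>exp\<close> into the closed
  unit disc, where \<open>f\<close> is bounded.\<close>

lemma W_bounded_left: "\<exists>M. \<forall>x\<le>0. \<forall>y. W (Complex x y) \<le> M"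
proof -
  have "continuous_on (cball 0 1) f"
    using holomorphic_on_imp_continuous_on[OF holomorphic_on_subset[OF holo]] by simp
  then have "compact (f ` cball 0 1)"
    by (rule compact_continuous_image) simp
  then obtain K where "\<forall>w\<in>f ` cball 0 1. cmod w \<le> K"
    using compact_imp_bounded bounded_iff by metis
  then have K: "cmod (f z) \<le> K" if "cmod z \<le> 1" for z
    using that by simp
  have "W (Complex x y) \<le> K^2 + 1/2" if "x \<le> 0" for x y
  proof -
    have "cmod (f (of_real (exp x) * cis y)) \<le> K"
      using that by (intro K) (simp add: norm_mult del: of_real_exp)
    then have "s (Complex x y) \<le> K^2"
      unfolding s_eq by (rule power_mono) simp
    moreover have "cutoff_log t \<le> max 0 (t + 1/2)" for t
      using cutoff_log_eq_0[of t] cutoff_log_le[of t] ln_le_minus_one[of t] by (cases "t \<le> 1") auto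
    moreover have "0 \<le> K^2" by simp
    ultimately show ?thesis
      unfolding W_def using order_trans[of "cutoff_log (s (Complex x y))" "max 0 (s (Complex x y) + 1/2)" "K^2 + 1/2"] by simp
  qed
  then show ?thesis by blast
qed

lemma \<phi>_bounded_left: "\<exists>M. \<forall>x\<le>0. \<phi> x \<le> M"
proof -
  obtain M where M: "\<And>x y. x \<le> 0 \<Longrightarrow> W (Complex x y) \<le> M"
    using W_bounded_left by blast
  have "\<phi> x \<le> integral {0..2*pi} (\<lambda>y. M^2)" if "x \<le> 0" for x
    unfolding \<phi>_def
    by (intro integral_le integrable_continuous_real continuous_intros continuous_line power_mono M that W_nonneg)
  then show ?thesis by blast
qed

text \<open>A convex function with a negative slope somewhere grows at least linearly to the left,
  but \<open>\<phi>\<close> is bounded there.\<close>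

lemma \<phi>1_nonneg: "\<phi>1 a \<ge> 0"
proof (rule ccontr)
  assume neg: "\<not> \<phi>1 a \<ge> 0"
  obtain M where M: "\<And>x. x \<le> 0 \<Longrightarrow> \<phi> x \<le> M"
    using \<phi>_bounded_left by blast
  \<comment> \<open>So far left of \<open>a\<close> that the slope \<open>\<phi>1 a\<close> alone
    forces \<open>\<phi> x \<ge> \<bar>M\<bar> + 1\<close>; the inner minimum ensures
    \<open>x \<le> 0\<close> and \<open>x < a\<close>.\<close>
  define x where "x = min (min 0 (a - 1)) (a - (\<bar>M\<bar> + 1) / - \<phi>1 a)"
  have "x < a" by (simp add: x_def)
  then obtain z where z: "z < a" "\<phi> a - \<phi> x = (a - x) * \<phi>1 z"
    using MVT2[of x a \<phi> \<phi>1] DERIV_\<phi> by blast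
  have "(a - x) * \<phi>1 z \<le> (a - x) * \<phi>1 a"
    using \<open>x < a\<close> z by (intro mult_left_mono \<phi>1_mono) auto
  moreover have "a - x \<ge> (\<bar>M\<bar> + 1) / - \<phi>1 a"
    by (simp add: x_def min_def)
  then have "(a - x) * (- \<phi>1 a) \<ge> \<bar>M\<bar> + 1"
    using neg by (simp add: pos_divide_le_eq del: divide_minus_right)
  ultimately have "\<phi> x \<ge> \<bar>M\<bar> + 1"
    using z \<phi>_nonneg[of a] by (simp add: algebra_simps)
  moreover have "\<phi> x \<le> M" by (rule M) (simp add: x_def)
  ultimately show False by linarith
qed

lemma W_ge: "cmod (f (of_real (exp x) * cis y)) \<le> exp (W (Complex x y) + 2)"
proof (cases "cmod (f (of_real (exp x) * cis y)) \<le> 1")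
  case True
  moreover have "1 \<le> exp (W (Complex x y) + 2)" using W_nonneg[of "Complex x y"] by simp
  ultimately show ?thesis by linarith
next
  case False
  define c where "c = cmod (f (of_real (exp x) * cis y))"
  have c: "c > 1" using False by (simp add: c_def)
  have "ln (c^2) - 3/2 \<le> W (Complex x y)"
    unfolding W_def s_eq c_def[symmetric] using c by (intro cutoff_log_ge) simp
  then have "2 * ln c \<le> W (Complex x y) + 2" using c by (simp add: ln_realpow)
  then have "ln c \<le> W (Complex x y) + 2" using c ln_gt_zero[of c] by linarith
  then show ?thesis using c by (simp add: c_def[symmetric] ln_le_cancel_iff flip: ln_ge_iff) (metis exp_le_cancel_iff exp_ln less_trans zero_less_one)
qed

text \<open>If \<open>\<phi>1\<close> vanished identically, so would \<open>\<phi>2\<close>, and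
  \<open>\<phi>2_ge\<close> would give \<open>Wx = 0\<close>. Then \<open>W\<close> would not depend
  on \<open>x\<close>, the bound for \<open>x \<le> 0\<close> would hold everywhere, and Liouville's
  theorem would make \<open>f\<close> constant.\<close>

lemma \<phi>1_pos_ex:
  assumes "\<not> f constant_on UNIV"
  shows "\<exists>x0. \<phi>1 x0 > 0"
proof (rule ccontr)
  assume "\<not> ?thesis"
  then have 0: "\<phi>1 = (\<lambda>_. 0)" using \<phi>1_nonneg by (simp add: fun_eq_iff not_less order_antisym)
  have "(\<phi>1 has_real_derivative 0) (at x)" for x unfolding 0 by simp
  then have \<phi>2_0: "\<phi>2 x = 0" for x using DERIV_unique[OF DERIV_\<phi>1] by blast
  have "0 \<le> integral {0..2*pi} (\<lambda>y. (Wx (Complex x y))^2)" for x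
    by (intro integral_nonneg integrable_continuous_real continuous_intros continuous_line) auto
  note nonneg = this
  have "integral {0..2*pi} (\<lambda>y. (Wx (Complex x y))^2) = 0" for x
    using \<phi>2_ge[of x] Dy_nonneg[of x] \<phi>2_0[of x] nonneg[of x] by linarith
  moreover have "continuous_on {0..2*pi} (\<lambda>y. (Wx (Complex x y))^2)" for x
    by (intro continuous_intros continuous_line)
  ultimately have Wx0: "Wx (Complex x y) = 0" if "y \<in> {0..2*pi}" for x y
    using that integral_eq_0_iff[of 0 "2*pi" "\<lambda>y. (Wx (Complex x y))^2"] by simp
  obtain M where M: "\<And>x y. x \<le> 0 \<Longrightarrow> W (Complex x y) \<le> M"
    using W_bounded_left by blast
  have W_le: "W (Complex x y) \<le> M" if "y \<in> {0..2*pi}" for x y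
  proof -
    have "W (Complex x y) = W (Complex 0 y)"
      by (rule DERIV_isconst_all[where f = "\<lambda>x. W (Complex x y)"]) (use DERIV_W(1)[of y] Wx0[OF that] in simp)
    then show ?thesis using M by simp
  qed
  have "cmod (f z) \<le> max (cmod (f 0)) (exp (M + 2))" for z
  proof (cases "z = 0")
    case False
    have z: "z = of_real (exp (ln (cmod z))) * cis (Arg2pi z)"
      using False Arg2pi_eq[of z] by (simp add: cis_conv_exp)
    have "W (Complex (ln (cmod z)) (Arg2pi z)) \<le> M"
      by (rule W_le) (simp add: Arg2pi_ge_0 Arg2pi_lt_2pi less_imp_le)
    then have "cmod (f z) \<le> exp (M + 2)"
      using W_ge[of "ln (cmod z)" "Arg2pi z"] by (subst z) (rule order_trans, assumption, simp)
    then show ?thesis by simp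
  qed simp
  then have "bounded (range f)" by (auto simp: bounded_iff)
  with Liouville_theorem[OF holo] assms show False by blast
qed

text \<open>A zero of the nonnegative function \<open>\<phi>\<close> is a minimum, where its
  derivative vanishes.\<close>

lemma \<phi>_pos: "\<phi> x > 0" if "\<phi>1 x > 0"
proof (rule ccontr)
  assume "\<not> \<phi> x > 0"
  then have "\<phi> x = 0" using \<phi>_nonneg[of x] by linarith
  then have "\<phi>1 x = 0"
    using DERIV_local_min[OF DERIV_\<phi>, of 1 x] \<phi>_nonneg by simp
  with that show False by simp
qed

text \<open>Exponential type gives \<open>W \<le> L * exp x\<close>; squaring produces the exponent
  \<open>2 * x\<close>. The type itself enters only the constant.\<close>

lemma \<phi>_growth:
  assumes "finite_exponential_type f"
  shows "\<exists>K. \<forall>x\<ge>0. \<phi> x \<le> K * exp (2 * x)"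
proof -
  obtain A B where AB: "A > 0" "B > 0" "\<And>z. cmod (f z) \<le> A * exp (B * cmod z)"
    using assms by (auto simp: finite_exponential_type_def)
  define L where "L = 2 * \<bar>ln A\<bar> + 2 * B + 1"
  have le: "W (Complex x y) \<le> L * exp x" if "x \<ge> 0" for x y
  proof (cases "s (Complex x y) \<le> 1")
    case True
    then show ?thesis using AB by (simp add: W_def cutoff_log_eq_0 L_def)
  next
    case False
    define c where "c = cmod (f (of_real (exp x) * cis y))"
    have c: "c > 1" "s (Complex x y) = c^2"
      using False by (auto simp: s_eq c_def power_le_one not_le[symmetric])
    have "c \<le> A * exp (B * exp x)"
      unfolding c_def using AB(3)[of "of_real (exp x) * cis y"] by (simp add: norm_mult del: of_real_exp)
    then have "ln c \<le> ln (A * exp (B * exp x))"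
      using c AB by simp
    also have "\<dots> = ln A + B * exp x" using AB by (simp add: ln_mult)
    finally have "W (Complex x y) \<le> 2 * ln A + 2 * B * exp x + 1/2"
      using cutoff_log_le[of "c^2"] c by (simp add: W_def ln_realpow)
    also have "\<dots> \<le> (2 * \<bar>ln A\<bar> + 1) * 1 + 2 * B * exp x"
      by simp
    also have "\<dots> \<le> (2 * \<bar>ln A\<bar> + 1) * exp x + 2 * B * exp x"
      using that AB(2) by (intro add_mono mult_left_mono) auto
    also have "\<dots> = L * exp x" by (simp add: L_def algebra_simps)
    finally show ?thesis .
  qed
  have "\<phi> x \<le> (2 * pi * L^2) * exp (2 * x)" if "x \<ge> 0" for x
  proof -
    have "\<phi> x \<le> integral {0..2*pi} (\<lambda>y. (L * exp x)^2)"
      unfolding \<phi>_def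
      by (intro integral_le integrable_continuous_real continuous_intros continuous_line power_mono le that W_nonneg)
    moreover have "(L * exp x)^2 = L^2 * exp (2 * x)"
      by (simp add: power_mult_distrib exp_double)
    ultimately show ?thesis by (simp add: mult_ac)
  qed
  then show ?thesis by blast
qed

text \<open>Since \<open>\<phi>1\<close> is monotone and \<open>\<phi> \<ge> 0\<close>, the mean
  value theorem on \<open>[x, x + 1]\<close> gives
  \<open>\<phi>1 x \<le> \<phi> (x + 1)\<close>.\<close>

lemma \<phi>1_growth:
  assumes "finite_exponential_type f"
  shows "\<exists>K>0. \<forall>x\<ge>0. \<phi>1 x \<le> K * exp (2 * x)"
proof -
  obtain K where K: "\<And>x. x \<ge> 0 \<Longrightarrow> \<phi> x \<le> K * exp (2 * x)"
    using \<phi>_growth[OF assms] by blast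
  have "\<phi>1 x \<le> (\<bar>K\<bar> * exp 2 + 1) * exp (2 * x)" if "x \<ge> 0" for x
  proof -
    obtain z where z: "z > x" "\<phi> (x + 1) - \<phi> x = (x + 1 - x) * \<phi>1 z"
      using MVT2[of x "x + 1" \<phi> \<phi>1] DERIV_\<phi> by auto
    have "\<phi>1 x \<le> \<phi>1 z" using z by (intro \<phi>1_mono) simp
    also have "\<dots> \<le> \<phi> (x + 1)" using z \<phi>_nonneg[of x] by simp
    also have "\<dots> \<le> K * exp (2 * (x + 1))" using that by (intro K) simp
    also have "\<dots> = K * exp 2 * exp (2 * x)" by (simp add: distrib_left exp_add)
    also have "\<dots> \<le> (\<bar>K\<bar> * exp 2 + 1) * exp (2 * x)"
      by (intro mult_right_mono) (auto intro: add_increasing2 mult_right_mono)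
    finally show ?thesis .
  qed
  moreover have "\<bar>K\<bar> * exp 2 + 1 > 0" by (simp add: add_nonneg_pos)
  ultimately show ?thesis by blast
qed

lemma continuous_\<Lambda>:
  assumes "\<And>x. x \<in> S \<Longrightarrow> \<phi> x > 0"
  shows "continuous_on S \<Lambda>"
proof -
  have "continuous_on UNIV (\<lambda>x. integral (cbox 0 (2*pi)) (\<lambda>y. (Wy (Complex x y))^2))"
    by (rule integral_continuous_on_param)
       (auto intro!: continuous_intros continuous_pair simp: split_beta)
  then have "continuous_on UNIV Dy" by (simp add: Dy_def[abs_def])
  moreover have "continuous_on UNIV \<phi>"
    using DERIV_continuous_on[of UNIV \<phi> \<phi>1] DERIV_\<phi> by blast
  ultimately show ?thesis
    unfolding \<Lambda>_def[abs_def] using assms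
    by (intro continuous_intros) (auto intro: continuous_on_subset dest!: assms)
qed

lemma \<Lambda>_nonneg: "\<Lambda> x \<ge> 0"
  by (simp add: \<Lambda>_def Dy_nonneg \<phi>_nonneg)

text \<open>\<open>\<Lambda>\<close> is dominated by \<open>\<phi>2 / (2 * \<phi>1)\<close>, the
  derivative of \<open>ln \<phi>1 / 2\<close>. The exponent \<open>2 * x\<close> in
  \<open>\<phi>1_growth\<close> makes the coefficient of \<open>T\<close> exactly
  \<open>1\<close>.\<close>

lemma integral_\<Lambda>_le:
  assumes "finite_exponential_type f" and "x0 \<ge> 0" and "\<phi>1 x0 > 0"
  shows "\<exists>K. \<forall>T\<ge>x0. integral {x0..T} \<Lambda> \<le> T + K"
proof -
  obtain K where K: "K > 0" "\<And>x. x \<ge> 0 \<Longrightarrow> \<phi>1 x \<le> K * exp (2 * x)"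
    using \<phi>1_growth[OF assms(1)] by blast
  have pos: "\<phi>1 x > 0" "\<phi> x > 0" if "x \<ge> x0" for x
    using \<phi>1_mono[OF that] assms(3) \<phi>_pos[of x] by auto
  have "integral {x0..T} \<Lambda> \<le> T + (ln K - ln (\<phi>1 x0)) / 2" if T: "T \<ge> x0" for T
  proof -
    have I: "((\<lambda>x. \<phi>2 x / (2 * \<phi>1 x)) has_integral ln (\<phi>1 T) / 2 - ln (\<phi>1 x0) / 2) {x0..T}"
    proof (rule fundamental_theorem_of_calculus[OF T])
      fix x assume "x \<in> {x0..T}"
      then have "((\<lambda>x. ln (\<phi>1 x) / 2) has_real_derivative \<phi>2 x / (2 * \<phi>1 x)) (at x)"
        using pos[of x] by (auto intro!: derivative_eq_intros DERIV_\<phi>1)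
      then show "((\<lambda>x. ln (\<phi>1 x) / 2) has_vector_derivative \<phi>2 x / (2 * \<phi>1 x)) (at x within {x0..T})"
        by (simp add: has_real_derivative_iff_has_vector_derivative has_vector_derivative_at_within)
    qed
    have "(\<Lambda> has_integral integral {x0..T} \<Lambda>) {x0..T}"
      by (intro integrable_integral integrable_continuous_real continuous_\<Lambda> pos) simp
    from has_integral_le[OF this I]
    have "integral {x0..T} \<Lambda> \<le> ln (\<phi>1 T) / 2 - ln (\<phi>1 x0) / 2"
      using \<phi>2_ge_mult_\<phi>1 pos by (auto simp: pos_le_divide_eq mult_ac)
    moreover have "ln (\<phi>1 T) \<le> ln (K * exp (2 * T))"
      using K(2)[of T] pos[OF T] T assms(2) by simp
    then have "ln (\<phi>1 T) \<le> ln K + 2 * T" using K(1) by (simp add: ln_mult)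
    ultimately show ?thesis by (simp add: field_simps)
  qed
  then show ?thesis by blast
qed

section \<open>From small Rayleigh quotients to long arcs\<close>

text \<open>If every interval of length \<open>l\<close> met a zero of \<open>W\<close>, then
  \<open>wirtinger_gaps\<close> would give \<open>Dy x \<ge> k^2 * \<phi> x\<close> for some
  \<open>k > \<Lambda> x\<close>, against the definition of \<open>\<Lambda>\<close>.\<close>

lemma \<Lambda>_arc:
  assumes "\<phi> x > 0" and "y0 \<in> {0..2*pi}" and "W (Complex x y0) = 0"
    and "l > 0" and "\<Lambda> x * l < pi"
  shows "\<exists>\<alpha>. \<forall>\<theta>\<in>{\<alpha>..\<alpha>+l}. W (Complex x \<theta>) > 0"
proof (rule ccontr)
  assume "\<not> ?thesis"
  then have zeros: "\<exists>\<theta>\<in>{\<alpha>..\<alpha>+l}. W (Complex x \<theta>) = 0" for \<alpha>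
    using W_nonneg by (metis less_eq_real_def)
  \<comment> \<open>\<open>k\<close> lies strictly between \<open>\<Lambda> x\<close> and
    \<open>pi / l\<close>, and \<open>\<eta>\<close> places \<open>k * (l + \<eta>)\<close> midway
    between \<open>k * l\<close> and \<open>pi\<close>.\<close>
  define k where "k = (\<Lambda> x + pi / l) / 2"
  define \<eta> where "\<eta> = (pi / k - l) / 2"
  have "\<Lambda> x < pi / l" using assms by (simp add: field_simps)
  then have k: "k > \<Lambda> x" "k < pi / l" 
    using less_half_sum[of "\<Lambda> x" "pi / l"] gt_half_sum[of "\<Lambda> x" "pi / l"] by (simp_all add: k_def)
  then have "k > 0" using \<Lambda>_nonneg[of x] by linarith
  have kl: "k * l < pi" using k assms by (simp add: field_simps)
  have \<eta>: "\<eta> > 0" using kl \<open>k > 0\<close> by (simp add: \<eta>_def field_simps)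
  have k\<eta>: "k * (l + \<eta>) < pi"
  proof -
    have "k * (l + \<eta>) = (pi + k * l) / 2" using \<open>k > 0\<close> by (simp add: \<eta>_def field_simps)
    then show ?thesis using kl by simp
  qed
  let ?h = "\<lambda>y. (Wy (Complex x y))^2 - k^2 * (W (Complex x y))^2"
  \<comment> \<open>The period starts at the zero \<open>y0\<close>, so that \<open>W\<close>
    vanishes at both ends; periodicity then moves the integral back to
    \<open>[0, 2*pi]\<close>.\<close>
  have "0 \<le> integral {y0..y0 + 2*pi} ?h"
    using W_periodic[of x y0] assms \<open>k > 0\<close>
    by (intro wirtinger_gaps[OF _ \<eta> \<open>l > 0\<close> k\<eta>] zeros DERIV_W continuous_line) auto
  also have "\<dots> = integral {0..2*pi} ?h"
    using assms(2) by (intro integral_period_shift continuous_intros continuous_line) (auto simp: W_periodic)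
  also have "\<dots> = Dy x - k^2 * \<phi> x"
    unfolding Dy_def \<phi>_def
    by (intro integral_unique has_integral_diff has_integral_mult_right integrable_integral
        integrable_continuous_real continuous_intros continuous_line)
  also have "Dy x = (\<Lambda> x)^2 * \<phi> x"
    using assms(1) Dy_nonneg[of x] by (simp add: \<Lambda>_def)
  finally have "k^2 * \<phi> x \<le> (\<Lambda> x)^2 * \<phi> x" by simp
  then have "k^2 \<le> (\<Lambda> x)^2" using assms(1) by simp
  then have "k \<le> \<Lambda> x" using \<Lambda>_nonneg by (rule power2_le_imp_le)
  then show False using k by simp
qed

lemma W_pos_ex: "\<exists>y\<in>{0..2*pi}. W (Complex x y) > 0" if "\<phi> x > 0"
proof (rule ccontr)
  assume "\<not> ?thesis"
  then have "W (Complex x y) = 0" if "y \<in> {0..2*pi}" for y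
    using that W_nonneg by (metis less_eq_real_def)
  then have "\<phi> x = integral {0..2*pi} (\<lambda>y. 0)"
    unfolding \<phi>_def by (intro Henstock_Kurzweil_Integration.integral_cong) simp
  with that show False by simp
qed

end

text \<open>Exports the Carleman estimate from the locale for use with two functions. A point of the
  circle with \<open>|f| \<le> 1\<close> supplies the zero of \<open>W\<close> required by
  \<open>\<Lambda>_arc\<close>.\<close>

lemma exponential_type_arcs:
  fixes f :: "complex \<Rightarrow> complex"
  assumes "f holomorphic_on UNIV" and "\<not> f constant_on UNIV" and "finite_exponential_type f"
  obtains x0 \<Lambda> K where "continuous_on {x0..} \<Lambda>" and "\<And>x. \<Lambda> x \<ge> 0"
    and "\<And>T. T \<ge> x0 \<Longrightarrow> integral {x0..T} \<Lambda> \<le> T + K"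
    and "\<And>x. x \<ge> x0 \<Longrightarrow> \<exists>\<theta>\<in>{0..2*pi}. cmod (f (of_real (exp x) * cis \<theta>)) > 1"
    and "\<And>x l. x \<ge> x0 \<Longrightarrow> \<exists>\<theta>\<in>{0..2*pi}. cmod (f (of_real (exp x) * cis \<theta>)) \<le> 1 \<Longrightarrow> l > 0 \<Longrightarrow>
      \<Lambda> x * l < pi \<Longrightarrow> \<exists>\<alpha>. \<forall>\<theta>\<in>{\<alpha>..\<alpha>+l}. cmod (f (of_real (exp x) * cis \<theta>)) > 1"
proof -
  interpret entire_function f by unfold_locales (rule assms)
  obtain x1 where "\<phi>1 x1 > 0" using \<phi>1_pos_ex[OF assms(2)] by blast
  define x0 where "x0 = max 0 x1"
  have x0: "x0 \<ge> 0" "\<phi>1 x0 > 0"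
    using \<open>\<phi>1 x1 > 0\<close> \<phi>1_mono[of x1 x0] by (auto simp: x0_def)
  have pos: "\<phi> x > 0" if "x \<ge> x0" for x
    using \<phi>1_mono[OF that] x0 \<phi>_pos[of x] by auto
  obtain K where K: "\<And>T. T \<ge> x0 \<Longrightarrow> integral {x0..T} \<Lambda> \<le> T + K"
    using integral_\<Lambda>_le[OF assms(3) x0] by blast
  have cont: "continuous_on {x0..} \<Lambda>" using pos by (intro continuous_\<Lambda>) simp
  have large: "\<exists>\<theta>\<in>{0..2*pi}. cmod (f (of_real (exp x) * cis \<theta>)) > 1" if "x \<ge> x0" for x
    using W_pos_ex[OF pos[OF that]] unfolding W_pos_iff .
  have arc: "\<exists>\<alpha>. \<forall>\<theta>\<in>{\<alpha>..\<alpha>+l}. cmod (f (of_real (exp x) * cis \<theta>)) > 1"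
    if x: "x \<ge> x0" and low: "\<exists>\<theta>\<in>{0..2*pi}. cmod (f (of_real (exp x) * cis \<theta>)) \<le> 1"
      and l: "l > 0" "\<Lambda> x * l < pi" for x l
  proof -
    obtain y0 where y0: "y0 \<in> {0..2*pi}" "\<not> W (Complex x y0) > 0"
      using low unfolding W_pos_iff by (auto simp: not_less)
    then have "W (Complex x y0) = 0" using W_nonneg[of "Complex x y0"] by linarith
    then show ?thesis
      using \<Lambda>_arc[OF pos[OF x] y0(1) _ l] unfolding W_pos_iff by blast
  qed
  show thesis by (rule that[OF cont \<Lambda>_nonneg K large arc])
qed

subsection \<open>Pairs of disjoint arcs\<close>

text \<open>Markov's inequality on the compact truncations \<open>S n\<close> bounds their measures
  by \<open>K / \<delta>\<close> uniformly, and the bound passes to their increasing union.\<close>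

lemma lmeasurable_superlevel:
  fixes h :: "real \<Rightarrow> real"
  assumes cont: "continuous_on {a..} h" and nonneg: "\<And>x. x \<ge> a \<Longrightarrow> h x \<ge> 0"
    and bound: "\<And>T. T \<ge> a \<Longrightarrow> integral {a..T} h \<le> K" and "\<delta> > 0"
  shows "{x. x \<ge> a \<and> h x \<ge> \<delta>} \<in> lmeasurable"
proof -
  define S where "S n = {x \<in> {a..a + real n}. h x \<ge> \<delta>}" for n
  have cont': "continuous_on {a..T} h" for T
    by (rule continuous_on_subset[OF cont]) auto
  have "closed ({a..a + real n} \<inter> h -` {\<delta>..})" for n
    by (rule continuous_closed_preimage[OF cont']) auto
  also have "{a..a + real n} \<inter> h -` {\<delta>..} = S n" for n
    by (auto simp: S_def)
  finally have "compact (S n)" for n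
    unfolding compact_eq_bounded_closed
    by (intro conjI bounded_subset[of "{a..a + real n}" "S n"]) (auto simp: S_def)
  then have S: "S n \<in> lmeasurable" for n by (rule lmeasurable_compact)
  have "measure lebesgue (S n) \<le> K / \<delta>" for n
  proof -
    have eq: "S n \<inter> {a..a + real n} = S n" by (auto simp: S_def)
    have I: "((\<lambda>x. \<delta> * indicator (S n) x) has_integral (\<delta> * measure lebesgue (S n))) {a..a + real n}"
      using S[of n] eq integrable_on_indicator[of "S n" "{a..a + real n}"]
        integral_indicator[of "S n" "{a..a + real n}"]
      by (intro has_integral_mult_right) (simp add: has_integral_iff)
    have J: "(h has_integral integral {a..a + real n} h) {a..a + real n}"
      by (intro integrable_integral integrable_continuous_real cont')
    have "\<delta> * measure lebesgue (S n) \<le> integral {a..a + real n} h"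
      by (rule has_integral_le[OF I J]) (auto simp: S_def indicator_def nonneg)
    also have "\<dots> \<le> K" by (rule bound) simp
    finally show ?thesis using \<open>\<delta> > 0\<close> by (simp add: field_simps)
  qed
  moreover have "S n \<subseteq> S (Suc n)" for n by (auto simp: S_def)
  ultimately have "(\<Union>n. S n) \<in> lmeasurable"
    by (rule measurable_nested_Union[OF S])
  also have "(\<Union>n. S n) = {x. x \<ge> a \<and> h x \<ge> \<delta>}"
  proof (intro equalityI subsetI)
    fix x assume x: "x \<in> {x. x \<ge> a \<and> h x \<ge> \<delta>}"
    obtain n where "x - a \<le> real n" using real_arch_simple by blast
    then show "x \<in> (\<Union>n. S n)" using x by (auto simp: S_def intro!: exI[of _ n])
  qed (auto simp: S_def)
  finally show ?thesis .
qed

section \<open>Angular measure of arcs\<close>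

text \<open>After a shift that brings the left endpoint into \<open>[0, 2*pi)\<close>, the angles
  form one interval, or two if the arc wraps past \<open>2*pi\<close>. The strict bound on
  \<open>b\<close> keeps these two disjoint.\<close>

lemma angle_set_arc:
  assumes "r > 0" and "a \<le> b" and "b < a + 2*pi"
  defines "A \<equiv> angle_set r ((\<lambda>\<theta>. of_real r * cis \<theta>) ` {a..b})"
  shows "A \<in> lmeasurable \<and> measure lebesgue A = b - a"
proof -
  define n where "n = \<lfloor>a / (2*pi)\<rfloor>"
  define a' where "a' = a - 2*pi * of_int n"
  define b' where "b' = b - 2*pi * of_int n"
  have "of_int n \<le> a / (2*pi)" "a / (2*pi) < of_int n + 1" by (auto simp: n_def)
  then have a': "0 \<le> a'" "a' < 2*pi" by (auto simp: a'_def field_simps)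
  have b': "a' \<le> b'" "b' < a' + 2*pi" using assms by (auto simp: a'_def b'_def)
  have mem: "\<theta> \<in> A \<longleftrightarrow> \<theta> \<in> {0..<2*pi} \<and> (\<exists>k::int. \<theta> + 2*pi * of_int k \<in> {a'..b'})" for \<theta>
  proof -
    have "cis \<theta> = cis t \<longleftrightarrow> (\<exists>k::int. t = \<theta> + 2*pi * of_int k)" for t
      using sin_cos_eq_iff[of t \<theta>] by (auto simp: complex_eq_iff)
    then have "\<theta> \<in> A \<longleftrightarrow> \<theta> \<in> {0..<2*pi} \<and> (\<exists>k::int. \<theta> + 2*pi * of_int k \<in> {a..b})"
      using \<open>r > 0\<close> by (auto simp: A_def angle_set_def image_iff)
    also have "(\<exists>k::int. \<theta> + 2*pi * of_int k \<in> {a..b}) \<longleftrightarrow> (\<exists>k::int. \<theta> + 2*pi * of_int k \<in> {a'..b'})"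
    proof safe
      fix k :: int assume "\<theta> + 2*pi * of_int k \<in> {a..b}"
      then show "\<exists>k::int. \<theta> + 2*pi * of_int k \<in> {a'..b'}"
        by (intro exI[of _ "k - n"]) (simp add: a'_def b'_def algebra_simps)
    next
      fix k :: int assume "\<theta> + 2*pi * of_int k \<in> {a'..b'}"
      then show "\<exists>k::int. \<theta> + 2*pi * of_int k \<in> {a..b}"
        by (intro exI[of _ "k + n"]) (simp add: a'_def b'_def algebra_simps)
    qed
    finally show ?thesis .
  qed
  have k01: "k = 0 \<or> k = 1" if "\<theta> \<in> {0..<2*pi}" "\<theta> + 2*pi * of_int k \<in> {a'..b'}" for \<theta> and k :: int
  proof -
    have "k < 2"
    proof (rule ccontr)
      assume "\<not> k < 2"
      then have "2*pi * 2 \<le> 2*pi * of_int k" by (intro mult_left_mono) auto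
      with that a' b' show False by auto
    qed
    moreover have "k > -1"
    proof (rule ccontr)
      assume "\<not> k > -1"
      then have "2*pi * of_int k \<le> 2*pi * (-1)" by (intro mult_left_mono) auto
      with that a' show False by auto
    qed
    ultimately show ?thesis by linarith
  qed
  show ?thesis
  proof (cases "b' < 2*pi")
    case True
    have "A = {a'..b'}"
    proof (intro equalityI subsetI)
      fix \<theta> assume "\<theta> \<in> A"
      then obtain k :: int where "\<theta> \<in> {0..<2*pi}" "\<theta> + 2*pi * of_int k \<in> {a'..b'}" using mem by blast
      with k01[OF this] True show "\<theta> \<in> {a'..b'}" by auto
    next
      fix \<theta> assume "\<theta> \<in> {a'..b'}"
      then show "\<theta> \<in> A" using a' True by (auto simp: mem intro!: exI[of _ 0])
    qed
    then show ?thesis using b' by (simp add: a'_def b'_def)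
  next
    case False
    have A: "A = {a'..<2*pi} \<union> {0..b' - 2*pi}"
    proof (intro equalityI subsetI)
      fix \<theta> assume "\<theta> \<in> A"
      then obtain k :: int where "\<theta> \<in> {0..<2*pi}" "\<theta> + 2*pi * of_int k \<in> {a'..b'}" using mem by blast
      with k01[OF this] show "\<theta> \<in> {a'..<2*pi} \<union> {0..b' - 2*pi}" by auto
    next
      fix \<theta> assume "\<theta> \<in> {a'..<2*pi} \<union> {0..b' - 2*pi}"
      then consider "\<theta> \<in> {a'..<2*pi}" | "\<theta> \<in> {0..b' - 2*pi}" by blast
      then show "\<theta> \<in> A"
      proof cases
        case 1
        then show ?thesis using a' False by (auto simp: mem intro!: exI[of _ 0])
      next
        case 2
        then show ?thesis using a' b' by (auto simp: mem intro!: exI[of _ 1])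
      qed
    qed
    have "{a'..<2*pi} \<inter> {0..b' - 2*pi} = {}" using b' by auto
    moreover have m: "{a'..<2*pi} \<in> lmeasurable" "measure lebesgue {a'..<2*pi} = 2*pi - a'"
      using a' by (auto intro: bounded_set_imp_lmeasurable)
    ultimately have "measure lebesgue A = (2*pi - a') + (b' - 2*pi)"
      unfolding A using False by (subst measure_Un3) auto
    moreover have "A \<in> lmeasurable" unfolding A by (intro fmeasurable.Un m) simp
    ultimately show ?thesis by (simp add: a'_def b'_def)
  qed
qed

section \<open>Position and opening of two disjoint arcs\<close>

text \<open>Shift the second arc so that its left end \<open>\<gamma>\<close> lies in
  \<open>[\<alpha>, \<alpha> + 2*pi)\<close>. Disjointness keeps \<open>\<gamma>\<close> off the
  first arc and keeps \<open>\<alpha> + 2*pi\<close>, a translate of \<open>\<alpha>\<close>, off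
  the second.\<close>

lemma disjoint_periodic_arcs:
  fixes P Q :: "real \<Rightarrow> bool"
  assumes perP: "\<And>\<theta> k::int. P (\<theta> + 2*pi * of_int k) = P \<theta>" and perQ: "\<And>\<theta> k::int. Q (\<theta> + 2*pi * of_int k) = Q \<theta>"
    and disj: "\<And>\<theta>. \<not> (P \<theta> \<and> Q \<theta>)" and "l > 0" and "m > 0"
    and P: "\<And>\<theta>. \<theta> \<in> {\<alpha>..\<alpha>+l} \<Longrightarrow> P \<theta>" and Q: "\<And>\<theta>. \<theta> \<in> {\<beta>..\<beta>+m} \<Longrightarrow> Q \<theta>"
  shows "\<exists>\<gamma>. \<alpha> + l < \<gamma> \<and> \<gamma> + m < \<alpha> + 2*pi \<and> (\<forall>\<theta>\<in>{\<gamma>..\<gamma>+m}. Q \<theta>)"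
proof -
  define n where "n = \<lfloor>(\<beta> - \<alpha>) / (2*pi)\<rfloor>"
  define \<gamma> where "\<gamma> = \<beta> - 2*pi * of_int n"
  have "of_int n \<le> (\<beta> - \<alpha>) / (2*pi)" "(\<beta> - \<alpha>) / (2*pi) < of_int n + 1" by (auto simp: n_def)
  then have \<gamma>: "\<alpha> \<le> \<gamma>" "\<gamma> < \<alpha> + 2*pi" by (auto simp: \<gamma>_def field_simps)
  have Q\<gamma>: "Q \<theta>" if "\<theta> \<in> {\<gamma>..\<gamma>+m}" for \<theta>
    using Q[of "\<theta> + 2*pi * of_int n"] perQ[of \<theta> n] that by (auto simp: \<gamma>_def)
  have "\<gamma> \<notin> {\<alpha>..\<alpha>+l}" using P[of \<gamma>] Q\<gamma>[of \<gamma>] disj \<open>m > 0\<close> by auto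
  moreover have "P (\<alpha> + 2*pi)" using P[of \<alpha>] perP[of \<alpha> 1] \<open>l > 0\<close> by simp
  then have "\<alpha> + 2*pi \<notin> {\<gamma>..\<gamma>+m}" using Q\<gamma> disj by blast
  ultimately show ?thesis using \<gamma> Q\<gamma> by (intro exI[of _ \<gamma>]) auto
qed

text \<open>Letting \<open>l\<close> and \<open>m\<close> approach \<open>pi / p\<close> and
  \<open>pi / q\<close> suggests \<open>1/p + 1/q \<le> 2\<close>, that is,
  \<open>p + q \<le> 2 * (p * q)\<close>. Hence
  \<open>(p - q)^2 \<le> (p + q) * (p + q - 2)\<close>, so \<open>p + q \<ge> 2\<close>, and near
  equality both rates are close to \<open>1\<close>.\<close>

lemma opening_rates:
  fixes p q :: real
  assumes "p \<ge> 0" and "q \<ge> 0"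
    and arcs: "\<And>l m. l > 0 \<Longrightarrow> m > 0 \<Longrightarrow> p * l < pi \<Longrightarrow> q * m < pi \<Longrightarrow> l + m < 2*pi"
  shows "p + q \<ge> 2"
    and "0 < \<eta> \<Longrightarrow> \<eta> < 1 \<Longrightarrow> p + q < 2 + \<eta>^2 \<Longrightarrow> p * (pi * (1 - \<eta>)) < pi \<and> q * (pi * (1 - \<eta>)) < pi"
proof -
  have small: "\<exists>m>0. c * m < pi" if "c \<ge> 0" for c
    using that by (intro exI[of _ "pi / (c + 1)"]) (auto simp: field_simps)
  have "p \<noteq> 0"
  proof
    assume "p = 0"
    obtain m where "m > 0" "q * m < pi" using small[OF \<open>q \<ge> 0\<close>] by blast
    then show False using arcs[of "2*pi" m] \<open>p = 0\<close> by simp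
  qed
  moreover have "q \<noteq> 0"
  proof
    assume "q = 0"
    obtain m where "m > 0" "p * m < pi" using small[OF \<open>p \<ge> 0\<close>] by blast
    then show False using arcs[of m "2*pi"] \<open>q = 0\<close> by simp
  qed
  ultimately have pos: "p > 0" "q > 0" using assms by auto
  have "p + q \<le> 2 * (p * q)"
  proof (rule ccontr)
    assume "\<not> ?thesis"
    then have *: "pi * (2 * (p * q)) < pi * (p + q)" by simp
    \<comment> \<open>These lengths sum to exactly \<open>2*pi\<close>, and both products equal
      \<open>2*pi * p * q / (p + q)\<close>, which the negated claim puts below
      \<open>pi\<close>.\<close>
    have "p * (2*pi * q / (p + q)) < pi" "q * (2*pi * p / (p + q)) < pi"
      using * pos by (simp_all add: divide_less_eq algebra_simps)
    then have "2*pi * q / (p + q) + 2*pi * p / (p + q) < 2*pi"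
      using pos by (intro arcs) auto
    moreover have "2*pi * q / (p + q) + 2*pi * p / (p + q) = (2*pi * q + 2*pi * p) / (p + q)"
      by (simp only: add_divide_distrib)
    then have "2*pi * q / (p + q) + 2*pi * p / (p + q) = 2*pi"
      using pos by (simp add: divide_eq_eq algebra_simps)
    ultimately show False by simp
  qed
  moreover have sq: "(p - q)^2 = (p + q)^2 - 4 * (p * q)"
    by (simp add: power2_eq_square algebra_simps)
  ultimately have diff: "(p - q)^2 \<le> (p + q) * (p + q - 2)"
    by (simp add: power2_eq_square algebra_simps)
  then have "(p + q) * (p + q - 2) \<ge> 0"
    using zero_le_power2[of "p - q"] by linarith
  then show ge: "p + q \<ge> 2" using pos by (simp add: zero_le_mult_iff)
  assume \<eta>: "0 < \<eta>" "\<eta> < 1" "p + q < 2 + \<eta>^2"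
  have "\<eta>^2 < 1" using \<eta> by (simp add: power_less_one_iff)
  \<comment> \<open>Crudely \<open>p + q \<le> 4\<close>; what matters is that
    \<open>\<bar>p - q\<bar>\<close> is at most \<open>2 * \<eta>\<close>, which bounds each rate by
    \<open>1 + \<eta> + \<eta>^2 / 2\<close>.\<close>
  have "(p + q) * (p + q - 2) \<le> 4 * \<eta>^2"
    using \<eta> ge pos \<open>\<eta>^2 < 1\<close> by (intro mult_mono) auto
  then have "\<bar>p - q\<bar>^2 \<le> (2 * \<eta>)^2" using diff by (simp add: power_mult_distrib)
  then have "\<bar>p - q\<bar> \<le> 2 * \<eta>" by (rule power2_le_imp_le) (use \<eta> in simp)
  then have "p \<le> 1 + \<eta> + \<eta>^2 / 2" "q \<le> 1 + \<eta> + \<eta>^2 / 2" using \<eta> by auto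
  moreover have "(1 + \<eta> + \<eta>^2 / 2) * (1 - \<eta>) < 1"
  proof -
    have "(1 + \<eta> + \<eta>^2 / 2) * (1 - \<eta>) = 1 - \<eta>^2 / 2 - \<eta>^3 / 2"
      by (simp add: field_simps power2_eq_square power3_eq_cube)
    moreover have "\<eta>^2 > 0" "\<eta>^3 > 0" using \<eta> by simp_all
    ultimately show ?thesis by linarith
  qed
  ultimately have "p * (1 - \<eta>) < 1" "q * (1 - \<eta>) < 1"
    using \<eta> by (auto intro: le_less_trans[OF mult_right_mono])
  then show "p * (pi * (1 - \<eta>)) < pi \<and> q * (pi * (1 - \<eta>)) < pi"
    using mult_strict_left_mono[of "p * (1 - \<eta>)" 1 pi] mult_strict_left_mono[of "q * (1 - \<eta>)" 1 pi]
    by (simp add: algebra_simps)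
qed

lemma exponential_type_pair_arcs:
  fixes f g :: "complex \<Rightarrow> complex"
  assumes f: "f holomorphic_on UNIV" "\<not> f constant_on UNIV" "finite_exponential_type f"
    and g: "g holomorphic_on UNIV" "\<not> g constant_on UNIV" "finite_exponential_type g"
    and min: "\<And>z. cmod (f z) \<le> 1 \<or> cmod (g z) \<le> 1" and \<eta>: "0 < \<eta>" "\<eta> < 1"
  shows "\<exists>E. E \<subseteq> {0..} \<and> E \<in> lmeasurable \<and> (\<forall>\<tau>\<in>{0..} - E. \<exists>\<alpha> \<beta>.
    \<alpha> + pi * (1 - \<eta>) < \<beta> \<and> \<beta> + pi * (1 - \<eta>) < \<alpha> + 2*pi \<and>
    (\<forall>\<theta>\<in>{\<alpha>..\<alpha> + pi * (1 - \<eta>)}. cmod (g (of_real (exp \<tau>) * cis \<theta>)) > 1) \<and>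
    (\<forall>\<theta>\<in>{\<beta>..\<beta> + pi * (1 - \<eta>)}. cmod (f (of_real (exp \<tau>) * cis \<theta>)) > 1))"
proof -
  define z where "z \<tau> \<theta> = of_real (exp \<tau>) * cis \<theta>" for \<tau> \<theta>
  have per: "z \<tau> (\<theta> + 2*pi * of_int k) = z \<tau> \<theta>" for \<tau> \<theta> and k :: int
    by (simp add: z_def flip: cis_mult)
  obtain xf P Kf where contf: "continuous_on {xf..} P" and P0: "\<And>x. P x \<ge> 0"
    and intf: "\<And>T. T \<ge> xf \<Longrightarrow> integral {xf..T} P \<le> T + Kf"
    and bigf: "\<And>x. x \<ge> xf \<Longrightarrow> \<exists>\<theta>\<in>{0..2*pi}. cmod (f (z x \<theta>)) > 1"
    and arcf: "\<And>x l. x \<ge> xf \<Longrightarrow> \<exists>\<theta>\<in>{0..2*pi}. cmod (f (z x \<theta>)) \<le> 1 \<Longrightarrow> l > 0 \<Longrightarrow> P x * l < pi \<Longrightarrow>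
      \<exists>\<alpha>. \<forall>\<theta>\<in>{\<alpha>..\<alpha>+l}. cmod (f (z x \<theta>)) > 1"
    unfolding z_def by (rule exponential_type_arcs[OF f]) blast
  obtain xg Q Kg where contg: "continuous_on {xg..} Q" and Q0: "\<And>x. Q x \<ge> 0"
    and intg: "\<And>T. T \<ge> xg \<Longrightarrow> integral {xg..T} Q \<le> T + Kg"
    and bigg: "\<And>x. x \<ge> xg \<Longrightarrow> \<exists>\<theta>\<in>{0..2*pi}. cmod (g (z x \<theta>)) > 1"
    and arcg: "\<And>x l. x \<ge> xg \<Longrightarrow> \<exists>\<theta>\<in>{0..2*pi}. cmod (g (z x \<theta>)) \<le> 1 \<Longrightarrow> l > 0 \<Longrightarrow> Q x * l < pi \<Longrightarrow>
      \<exists>\<alpha>. \<forall>\<theta>\<in>{\<alpha>..\<alpha>+l}. cmod (g (z x \<theta>)) > 1"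
    unfolding z_def by (rule exponential_type_arcs[OF g]) blast
  define x0 where "x0 = max 0 (max xf xg)"
  have x0: "x0 \<ge> 0" "x0 \<ge> xf" "x0 \<ge> xg" by (auto simp: x0_def)
  have arcs: "\<exists>\<alpha> \<beta>. \<alpha> + l < \<beta> \<and> \<beta> + m < \<alpha> + 2*pi \<and>
      (\<forall>\<theta>\<in>{\<alpha>..\<alpha>+l}. cmod (g (z x \<theta>)) > 1) \<and> (\<forall>\<theta>\<in>{\<beta>..\<beta>+m}. cmod (f (z x \<theta>)) > 1)"
    if x: "x \<ge> x0" and lm: "l > 0" "m > 0" "Q x * l < pi" "P x * m < pi" for x l m
  proof -
    \<comment> \<open>Each function exceeds \<open>1\<close> somewhere on the circle, and there the
      other one is at most \<open>1\<close>.\<close>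
    have "\<exists>\<theta>\<in>{0..2*pi}. cmod (f (z x \<theta>)) \<le> 1" "\<exists>\<theta>\<in>{0..2*pi}. cmod (g (z x \<theta>)) \<le> 1"
      using bigf[of x] bigg[of x] x x0 min by (meson not_le order_trans)+
    then obtain \<alpha> \<beta> where \<alpha>: "\<And>\<theta>. \<theta> \<in> {\<alpha>..\<alpha>+l} \<Longrightarrow> cmod (g (z x \<theta>)) > 1"
      and \<beta>: "\<And>\<theta>. \<theta> \<in> {\<beta>..\<beta>+m} \<Longrightarrow> cmod (f (z x \<theta>)) > 1"
      using arcf[of x m] arcg[of x l] lm x x0 by (meson order_trans)
    have "\<not> (cmod (g (z x \<theta>)) > 1 \<and> cmod (f (z x \<theta>)) > 1)" for \<theta>
      using min[of "z x \<theta>"] by auto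
    then have "\<exists>\<gamma>. \<alpha> + l < \<gamma> \<and> \<gamma> + m < \<alpha> + 2*pi \<and> (\<forall>\<theta>\<in>{\<gamma>..\<gamma>+m}. cmod (f (z x \<theta>)) > 1)"
      using lm \<alpha> \<beta> by (intro disjoint_periodic_arcs[where P = "\<lambda>\<theta>. cmod (g (z x \<theta>)) > 1" and \<beta> = \<beta>]) (simp_all add: per)
    then show ?thesis using \<alpha> by blast
  qed
  have rates: "\<And>l m. l > 0 \<Longrightarrow> m > 0 \<Longrightarrow> P x * l < pi \<Longrightarrow> Q x * m < pi \<Longrightarrow> l + m < 2*pi"
    if "x \<ge> x0" for x
    using arcs[OF that] by fastforce
  define h where "h x = P x + Q x - 2" for x
  have h0: "h x \<ge> 0" if "x \<ge> x0" for x
    using opening_rates(1)[OF P0 Q0 rates[OF that]] by (simp add: h_def)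
  have cont: "continuous_on {x0..} P" "continuous_on {x0..} Q"
    using x0 by (auto intro: continuous_on_subset[OF contf] continuous_on_subset[OF contg])
  have conth: "continuous_on {x0..} h"
    unfolding h_def[abs_def] by (intro continuous_intros cont)
  \<comment> \<open>The two bounds of the form \<open>T + K\<close> cancel against the integral of
    the constant \<open>2\<close>, so the estimate is uniform in \<open>T\<close>.\<close>
  have inth: "integral {x0..T} h \<le> Kf + Kg + 2 * x0" if T: "T \<ge> x0" for T
  proof -
    have int: "P integrable_on {a..T}" if "a \<ge> xf" for a
      using that by (intro integrable_continuous_real continuous_on_subset[OF contf]) auto
    have int': "Q integrable_on {a..T}" if "a \<ge> xg" for a
      using that by (intro integrable_continuous_real continuous_on_subset[OF contg]) auto
    have "(h has_integral (integral {x0..T} P + integral {x0..T} Q - 2 * (T - x0))) {x0..T}"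
      unfolding h_def[abs_def]
      using has_integral_const_real[of "2::real" x0 T] T x0
      by (intro has_integral_diff has_integral_add integrable_integral int int') (simp_all add: mult.commute)
    moreover have "integral {x0..T} P \<le> integral {xf..T} P"
      using x0 P0 by (intro integral_subset_le int) auto
    moreover have "integral {x0..T} Q \<le> integral {xg..T} Q"
      using x0 Q0 by (intro integral_subset_le int') auto
    moreover have "integral {xf..T} P \<le> T + Kf" "integral {xg..T} Q \<le> T + Kg"
      using T x0 intf[of T] intg[of T] by auto
    ultimately show ?thesis by (simp add: integral_unique)
  qed
  \<comment> \<open>The initial segment is discarded because the estimates begin at
    \<open>x0\<close>; the other part has finite measure by
    \<open>lmeasurable_superlevel\<close>.\<close>
  define E where "E = {0..x0} \<union> {x. x \<ge> x0 \<and> h x \<ge> \<eta>^2}"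
  have "E \<subseteq> {0..}" using x0 by (auto simp: E_def)
  moreover have "E \<in> lmeasurable"
    unfolding E_def using \<eta>
    by (intro fmeasurable.Un lmeasurable_superlevel[OF conth h0 inth]) auto
  moreover have "\<exists>\<alpha> \<beta>. \<alpha> + pi * (1 - \<eta>) < \<beta> \<and> \<beta> + pi * (1 - \<eta>) < \<alpha> + 2*pi \<and>
    (\<forall>\<theta>\<in>{\<alpha>..\<alpha> + pi * (1 - \<eta>)}. cmod (g (z \<tau> \<theta>)) > 1) \<and>
    (\<forall>\<theta>\<in>{\<beta>..\<beta> + pi * (1 - \<eta>)}. cmod (f (z \<tau> \<theta>)) > 1)" if "\<tau> \<in> {0..} - E" for \<tau>
  proof -
    have \<tau>: "\<tau> \<ge> x0" "P \<tau> + Q \<tau> < 2 + \<eta>^2" using that by (auto simp: E_def h_def)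
    show ?thesis
      using opening_rates(2)[OF P0 Q0 rates[OF \<tau>(1)] \<eta> \<tau>(2)] \<eta> by (intro arcs \<tau>) auto
  qed
  ultimately show ?thesis unfolding z_def by blast
qed

section \<open>From two long arcs to opposite semicircles\<close>

theorem theorem1p2:
  fixes f g :: "complex \<Rightarrow> complex"
  assumes "f holomorphic_on UNIV" and "g holomorphic_on UNIV"
    and "\<not> f constant_on UNIV" and "\<not> g constant_on UNIV"
    and "finite_exponential_type f" and "finite_exponential_type g"
    and "(SUP z. ereal (min (norm (f z)) (norm (g z)))) \<le> 1"
  shows "\<forall>\<epsilon>::real. \<epsilon> > 0 \<longrightarrow>
    (\<exists>E. E \<subseteq> {0..} \<and> E \<in> lmeasurable \<and>
      (\<forall>\<tau> \<in> {0..} - E. \<exists>C B.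
         semicircle (exp \<tau>) C \<and>
         B \<subseteq> sphere 0 (exp \<tau>) \<and>
         angular_measurable (exp \<tau>) B \<and> angular_measure (exp \<tau>) B \<le> \<epsilon> \<and>
         (\<forall>z \<in> C - B. norm (f z) \<le> 1 \<and> norm (g z) > 1) \<and>
         (\<forall>z \<in> uminus ` C - B. norm (f z) > 1 \<and> norm (g z) \<le> 1)))"
proof (intro allI impI)
  fix \<epsilon> :: real assume "\<epsilon> > 0"
  \<comment> \<open>\<open>B\<close> will consist of two arcs of measure \<open>2*pi*\<eta>\<close>
    each, whence \<open>\<epsilon> / (4*pi)\<close>; the bound \<open>1/4\<close> keeps
    \<open>\<kappa>\<close> positive.\<close>
  define \<eta> where "\<eta> = min (1/4) (\<epsilon> / (4*pi))"
  have \<eta>: "0 < \<eta>" "\<eta> < 1" "\<eta> \<le> 1/4" using \<open>\<epsilon> > 0\<close> by (auto simp: \<eta>_def)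
  have "\<eta> \<le> \<epsilon> / (4*pi)" by (simp add: \<eta>_def)
  then have \<eta>\<epsilon>: "4*pi * \<eta> \<le> \<epsilon>" by (simp add: pos_le_divide_eq mult.commute)
  define \<kappa> where "\<kappa> = pi * (1 - \<eta>) - pi * \<eta>"
  have \<kappa>: "0 < \<kappa>" "\<kappa> \<le> pi" "pi - \<kappa> = 2 * (pi * \<eta>)"
    using \<eta> mult_left_mono[of \<eta> "1/4" pi] pi_gt_zero by (auto simp: \<kappa>_def algebra_simps)
  have "ereal (min (norm (f z)) (norm (g z))) \<le> 1" for z
    using SUP_upper[of z UNIV "\<lambda>z. ereal (min (norm (f z)) (norm (g z)))"] assms(7) by simp
  then have min: "cmod (f z) \<le> 1 \<or> cmod (g z) \<le> 1" for z
    by (simp add: one_ereal_def min_le_iff_disj)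
  obtain E where E: "E \<subseteq> {0..}" "E \<in> lmeasurable" and arcs: "\<And>\<tau>. \<tau>\<in>{0..} - E \<Longrightarrow> \<exists>\<alpha> \<beta>.
    \<alpha> + pi * (1 - \<eta>) < \<beta> \<and> \<beta> + pi * (1 - \<eta>) < \<alpha> + 2*pi \<and>
    (\<forall>\<theta>\<in>{\<alpha>..\<alpha> + pi * (1 - \<eta>)}. cmod (g (of_real (exp \<tau>) * cis \<theta>)) > 1) \<and>
    (\<forall>\<theta>\<in>{\<beta>..\<beta> + pi * (1 - \<eta>)}. cmod (f (of_real (exp \<tau>) * cis \<theta>)) > 1)"
    using exponential_type_pair_arcs[OF assms(1,3,5) assms(2,4,6) min \<eta>(1,2)] by blast
  have "\<exists>C B. semicircle (exp \<tau>) C \<and> B \<subseteq> sphere 0 (exp \<tau>) \<and>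
         angular_measurable (exp \<tau>) B \<and> angular_measure (exp \<tau>) B \<le> \<epsilon> \<and>
         (\<forall>z \<in> C - B. norm (f z) \<le> 1 \<and> norm (g z) > 1) \<and>
         (\<forall>z \<in> uminus ` C - B. norm (f z) > 1 \<and> norm (g z) \<le> 1)" if \<tau>: "\<tau> \<in> {0..} - E" for \<tau>
  proof -
    define r where "r = exp \<tau>"
    define z where "z \<theta> = complex_of_real r * cis \<theta>" for \<theta>
    have "r > 0" by (simp add: r_def)
    obtain \<alpha> \<beta> where ab: "\<alpha> + pi * (1 - \<eta>) < \<beta>" "\<beta> + pi * (1 - \<eta>) < \<alpha> + 2*pi"
      and G: "\<And>\<theta>. \<theta>\<in>{\<alpha>..\<alpha> + pi * (1 - \<eta>)} \<Longrightarrow> cmod (g (z \<theta>)) > 1"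
      and F: "\<And>\<theta>. \<theta>\<in>{\<beta>..\<beta> + pi * (1 - \<eta>)} \<Longrightarrow> cmod (f (z \<theta>)) > 1"
      using arcs[OF \<tau>] unfolding z_def r_def by blast
    \<comment> \<open>The later of the starting angles of the \<open>g\<close>-arc and of the
      \<open>f\<close>-arc turned back by \<open>pi\<close>. These differ by less than
      \<open>pi * \<eta>\<close>, so both arcs still cover a length \<open>\<kappa>\<close> from
      \<open>\<gamma>\<close>.\<close>
    define \<gamma> where "\<gamma> = max \<alpha> (\<beta> - pi)"
    have \<gamma>: "\<alpha> \<le> \<gamma>" "\<gamma> + \<kappa> \<le> \<alpha> + pi * (1 - \<eta>)" "\<beta> \<le> \<gamma> + pi" "\<gamma> + pi + \<kappa> \<le> \<beta> + pi * (1 - \<eta>)"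
      using ab by (auto simp: \<gamma>_def \<kappa>_def algebra_simps)
    define C where "C = z ` {\<gamma>..\<gamma> + pi}"
    \<comment> \<open>\<open>B1\<close> and \<open>B2\<close> are the uncontrolled final pieces of
      \<open>C\<close> and of \<open>-C\<close>, which starts at
      \<open>\<gamma> + pi\<close>.\<close>
    define B1 where "B1 = z ` {\<gamma> + \<kappa>..\<gamma> + pi}"
    define B2 where "B2 = z ` {\<gamma> + pi + \<kappa>..\<gamma> + 2*pi}"
    have meas: "angle_set r (z ` {a..b}) \<in> lmeasurable" "measure lebesgue (angle_set r (z ` {a..b})) = b - a"
      if "a \<le> b" "b < a + 2*pi" for a b
      using angle_set_arc[OF \<open>r > 0\<close> that] unfolding z_def by auto
    have "circular_arc r C"
      unfolding circular_arc_def C_def z_def[abs_def] by (intro exI[of _ \<gamma>] exI[of _ "\<gamma> + pi"]) simp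
    then have "semicircle r C"
      unfolding semicircle_def angular_measure_def using meas[of \<gamma> "\<gamma> + pi"] by (simp add: C_def)
    moreover have "B1 \<union> B2 \<subseteq> sphere 0 r"
      using \<open>r > 0\<close> by (auto simp: B1_def B2_def z_def norm_mult)
    moreover have B: "angle_set r B1 \<in> lmeasurable" "measure lebesgue (angle_set r B1) = 2 * (pi * \<eta>)"
      "angle_set r B2 \<in> lmeasurable" "measure lebesgue (angle_set r B2) = 2 * (pi * \<eta>)"
      using meas[of "\<gamma> + \<kappa>" "\<gamma> + pi"] meas[of "\<gamma> + pi + \<kappa>" "\<gamma> + 2*pi"] \<kappa>
      by (auto simp: B1_def B2_def)
    have Un: "angle_set r (B1 \<union> B2) = angle_set r B1 \<union> angle_set r B2"
      by (auto simp: angle_set_def)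
    have "angular_measurable r (B1 \<union> B2)"
      unfolding angular_measurable_def Un using B by auto
    moreover have "angular_measure r (B1 \<union> B2) \<le> \<epsilon>"
      unfolding angular_measure_def Un
      using measure_Un_le[of "angle_set r B1" lebesgue "angle_set r B2"] B \<eta>\<epsilon> by (auto simp: fmeasurableD)
    moreover have "norm (f w) \<le> 1 \<and> norm (g w) > 1" if wC: "w \<in> C - (B1 \<union> B2)" for w
    proof -
      obtain \<theta> where \<theta>: "w = z \<theta>" "\<theta> \<in> {\<gamma>..\<gamma> + pi}" using wC by (auto simp: C_def)
      then have "\<theta> < \<gamma> + \<kappa>" using wC by (force simp: B1_def)
      then have "norm (g w) > 1" using \<theta> \<gamma> by (auto intro!: G)
      then show ?thesis using min[of w] by auto
    qed
    moreover have "norm (f w) > 1 \<and> norm (g w) \<le> 1" if wC: "w \<in> uminus ` C - (B1 \<union> B2)" for w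
    proof -
      obtain \<theta> where \<theta>: "w = - z \<theta>" "\<theta> \<in> {\<gamma>..\<gamma> + pi}" using wC by (auto simp: C_def)
      have w: "w = z (\<theta> + pi)" using \<theta>(1) by (simp add: z_def flip: cis_mult)
      have "\<theta> + pi < \<gamma> + pi + \<kappa>"
      proof (rule ccontr)
        assume "\<not> ?thesis"
        then have "w \<in> B2" unfolding w B2_def using \<theta> by (intro imageI) auto
        with wC show False by blast
      qed
      then have "norm (f w) > 1" unfolding w using \<theta> \<gamma> by (intro F) auto
      then show ?thesis using min[of w] by auto
    qed
    ultimately show ?thesis unfolding r_def[symmetric] by - (rule exI[where x = C], rule exI[where x = "B1 \<union> B2"], blast)
  qed
  then show "\<exists>E. E \<subseteq> {0..} \<and> E \<in> lmeasurable \<and>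
      (\<forall>\<tau> \<in> {0..} - E. \<exists>C B.
         semicircle (exp \<tau>) C \<and>
         B \<subseteq> sphere 0 (exp \<tau>) \<and>
         angular_measurable (exp \<tau>) B \<and> angular_measure (exp \<tau>) B \<le> \<epsilon> \<and>
         (\<forall>z \<in> C - B. norm (f z) \<le> 1 \<and> norm (g z) > 1) \<and>
         (\<forall>z \<in> uminus ` C - B. norm (f z) > 1 \<and> norm (g z) \<le> 1))"
    using E by blast
qed

end
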